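(* Let $1\le p,q<\infty$, $0\le\theta,\nu<1$ and $1\le r<\infty$ satisfy $\frac1r+\frac{1-\theta}{p}+\frac{1-\nu}{q}=1$, and let $r'$ be the conjugate exponent of $r$, $\frac1r+\frac1{r'}=1$. Let $X$ be a metric space, $F$ a Banach space and $T\in \mathrm{Lip}(X,F)$. The following conditions are equivalent. (1) $T$ is Lipschitz $(p,\theta,q,\nu)$-dominated, i.e. $T\in\mathcal{D}^{L}_{(p,\theta,q,\nu)}(X,F)$. (2) There are a constant $C\ge 0$ and regular Borel probability measures $\mu$ on $B_{X^{\#}}$ and $\tau$ on $B_{F^{**}}$ such that for all $x',x''\in X$ and $b^*\in F^*$ $$|\langle Tx'-Tx'',b^*\rangle|\le C\left[\int_{B_{X^{\#}}}\left(|f(x')-f(x'')|^{1-\theta}d_X(x',x'')^{\theta}\right)^{\frac{p}{1-\theta}}d\mu(f)\right]^{\frac{1-\theta}{p}}\left[\int_{B_{F^{**}}}\left(|\langle b^*,b^{**}\rangle|^{1-\nu}\|b^*\|^{\nu}\right)^{\frac{q}{1-\nu}}d\tau(b^{**})\right]^{\frac{1-\nu}{q}}.$$ (3) There is a constant $C\ge 0$ such that for all $m\in\mathbb{N}$ and all finite sequences $(x'_j)_{j=1}^m,(x''_j)_{j=1}^m$ in $X$, $(\sigma_j)_{j=1}^m$ in $\mathbb{R}$ and $(b_j^* )_{j=1}^m$ in $F^*$ $$\left[\sum_{j=1}^m|\sigma_j\langle Tx'_j-Tx''_j,b^*_j\rangle|^{r'}\right]^{\frac1{r'}}\le C\,\left\|(\sigma,x',x'')\,\big|\,\delta^{L}_{p,\theta}(\mathbb{R}\times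 X\times X)\right\|\,\left\|b^*\,\big|\,\delta_{q,\nu}(F^* )\right\|.$$ In this case, $D^{L}_{(p,\theta,q,\nu)}(T)$ is equal to the infimum of the constants $C$ in (2), and also to the infimum of the constants $C$ in (3).
   Context: Metric spaces are pointed with distinguished point $0$ (the origin in a Banach space). $\mathrm{Lip}(X,F)$ is the space of Lipschitz maps $T:X\to F$ with $T0=0$, normed by the Lipschitz constant $\mathrm{Lip}(T)$. $X^{\#}$ is the Banach space of scalar-valued Lipschitz functions on $X$ vanishing at $0$, with norm $\mathrm{Lip}(\cdot)$; its closed unit ball $B_{X^{\#}}$ is compact in the topology of pointwise convergence on $X$. $B_{F^{**}}$ is the closed unit ball of the bidual of $F$ with the weak$^*$ topology. For finite sequences, $$\|(\sigma,x',x'')|\delta^{L}_{p,\theta}(\mathbb{R}\times X\times X)\|=\sup_{f\in B_{X^{\#}}}\Big[\sum_j\left(|\sigma_j||f(x'_j)-f(x''_j)|^{1-\theta}d_X(x'_j,x''_j)^{\theta}\right)^{\frac{p}{1-\theta}}\Big]^{\frac{1-\theta}{p}},$$ and for a Banach space $E$ and a sequence $(x_j)$ in $E$, $$\|x|\delta_{q,\nu}(E)\|=\sup_{\xi\in B_{E^*}}\Big[\sum_j\left(|\langle x_j,\xi\rangle|^{1-\nu}\|x_j\|^{\nu}\right)^{\frac{q}{1-\nu}}\Big]^{\frac{1-\nu}{q}}.$$ $\Pi_q(E,H)$ denotes the absolutely $q$-summing operators between Banach spaces, with $q$-summing norm $\pi_q$. A map $S\in\mathrm{Lip}(X,G)$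 is Lipschitz $p$-summing, $S\in\Pi^L_p(X,G)$, if there is $C\ge0$ such that for all finite sequences $x',x''$ in $X$ and $\lambda$ in $\mathbb{R}^+$, $[\sum_j\lambda_j^p\|Sx'_j-Sx''_j\|^p]^{1/p}\le C\sup_{f\in B_{X^{\#}}}[\sum_j\lambda_j^p|f(x'_j)-f(x''_j)|^p]^{1/p}$; $\pi_p^L(S)$ is the infimum of such $C$. $T\in\mathrm{Lip}(X,F)$ is called Lipschitz $(p,\theta,q,\nu)$-dominated if there exist Banach spaces $G,H$, a Lipschitz operator $S\in\Pi^L_p(X,G)$, a bounded operator $R\in\Pi_q(F^*,H)$ and a constant $C>0$ such that $$|\langle Tx'-Tx'',b^*\rangle|\le C\,d_X(x',x'')^{\theta}\|Sx'-Sx''\|^{1-\theta}\|b^*\|^{\nu}\|Rb^*\|^{1-\nu}$$ for all $x',x''\in X$, $b^*\in F^*$. The class of such $T$ is $\mathcal{D}^{L}_{(p,\theta,q,\nu)}(X,F)$, and $D^{L}_{(p,\theta,q,\nu)}(T)=\inf\{C\,\pi^L_p(S)^{1-\theta}\,\pi_q(R)^{1-\nu}\}$, the infimum over all admissible $C,S,R$. *)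

theory Defs
  imports "HOL-Probability.Probability" "HOL-Probability.Discrete_Topology"
begin

type_synonym 'e dual = "'e \<Rightarrow>\<^sub>L real"

section \<open>Lipschitz maps on a pointed metric space\<close>

text \<open>The distinguished point is passed as the argument \<open>x0\<close>.\<close>

definition lip0 :: "'a::metric_space \<Rightarrow> ('a \<Rightarrow> 'f::real_normed_vector) set" where
  "lip0 x0 = {T. (\<exists>L. L-lipschitz_on UNIV T) \<and> T x0 = 0}"

definition lip_const :: "('a::metric_space \<Rightarrow> 'f::metric_space) \<Rightarrow> real" where
  "lip_const T = Inf {L. L-lipschitz_on UNIV T}"

definition lip_ball :: "'a::metric_space \<Rightarrow> ('a \<Rightarrow> real) set" where
  "lip_ball x0 = {f \<in> lip0 x0. lip_const f \<le> 1}"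

definition lip_ball_topology :: "'a::metric_space \<Rightarrow> ('a \<Rightarrow> real) topology" where
  "lip_ball_topology x0 =
     subtopology (product_topology (\<lambda>_. euclideanreal) UNIV) (lip_ball x0)"

text \<open>
  On a space of functionals, the strong operator topology is by definition the
  coarsest topology that makes all evaluations continuous, i.e. the weak* topology.
\<close>

definition dual_ball_topology :: "('e::real_normed_vector dual) topology" where
  "dual_ball_topology = subtopology strong_operator_topology (cball 0 1)"

definition regular_borel_prob :: "'c topology \<Rightarrow> 'c measure \<Rightarrow> bool" where
  "regular_borel_prob Y \<mu> \<longleftrightarrow>
     prob_space \<mu> \<and>
     space \<mu> = topspace Y \<and> sets \<mu> = sigma_sets (topspace Y) {U. openin Y U} \<and>
     (\<forall>A\<in>sets \<mu>. emeasure \<mu> A = (INF U\<in>{U. openin Y U \<and> A \<subseteq> U}. emeasure \<mu> U)) \<and>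
     (\<forall>A\<in>sets \<mu>. emeasure \<mu> A = (SUP K\<in>{K. compactin Y K \<and> K \<subseteq> A}. emeasure \<mu> K))"

text \<open>Finite sequences of length \<open>m\<close> are represented by their values at the indices \<open>j < m\<close>.\<close>

definition delta_lip ::
  "real \<Rightarrow> real \<Rightarrow> 'a::metric_space \<Rightarrow> nat \<Rightarrow> (nat \<Rightarrow> real) \<Rightarrow> (nat \<Rightarrow> 'a) \<Rightarrow> (nat \<Rightarrow> 'a) \<Rightarrow> real" where
  "delta_lip p \<theta> x0 m \<sigma> x' x'' =
     (SUP f\<in>lip_ball x0.
        (\<Sum>j<m. (\<bar>\<sigma> j\<bar> * \<bar>f (x' j) - f (x'' j)\<bar> powr (1 - \<theta>) * dist (x' j) (x'' j) powr \<theta>)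
                  powr (p / (1 - \<theta>))) powr ((1 - \<theta>) / p))"

definition delta_lin :: "real \<Rightarrow> real \<Rightarrow> nat \<Rightarrow> (nat \<Rightarrow> 'e::real_normed_vector) \<Rightarrow> real" where
  "delta_lin q \<nu> m x =
     (SUP \<xi>\<in>cball (0 :: 'e dual) 1.
        (\<Sum>j<m. (\<bar>blinfun_apply \<xi> (x j)\<bar> powr (1 - \<nu>) * norm (x j) powr \<nu>)
                  powr (q / (1 - \<nu>))) powr ((1 - \<nu>) / q))"


section \<open>Banach spaces as objects\<close>

text \<open>
  The Banach spaces through which an operator factors are existentially quantified, so
  they cannot be types. Such a space is a linear subspace \<open>V\<close> of some ambient real vector
  space together with a complete norm \<open>N\<close> on \<open>V\<close>; no norm or topology of the ambient space
  is used, and \<open>N\<close> is irrelevant outside \<open>V\<close>.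
\<close>

definition banach_on :: "'u::real_vector set \<Rightarrow> ('u \<Rightarrow> real) \<Rightarrow> bool" where
  "banach_on V N \<longleftrightarrow>
     subspace V \<and>
     (\<forall>x\<in>V. N x \<ge> 0 \<and> (N x = 0 \<longleftrightarrow> x = 0)) \<and>
     (\<forall>a. \<forall>x\<in>V. N (a *\<^sub>R x) = \<bar>a\<bar> * N x) \<and>
     (\<forall>x\<in>V. \<forall>y\<in>V. N (x + y) \<le> N x + N y) \<and>
     (\<forall>s :: nat \<Rightarrow> 'u. range s \<subseteq> V \<longrightarrow> (\<forall>e>0. \<exists>n0. \<forall>m\<ge>n0. \<forall>n\<ge>n0. N (s m - s n) < e) \<longrightarrow>
        (\<exists>l\<in>V. (\<lambda>n. N (s n - l)) \<longlonglongrightarrow> 0))"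

text \<open>Every Banach space given as a type occurs, up to isometric isomorphism, in each
  real vector space into which it embeds linearly.\<close>

lemma banach_on_range:
  fixes J :: "'g::banach \<Rightarrow> 'u::real_vector"
  assumes J: "linear J" "inj J"
  shows "banach_on (range J) (\<lambda>x. norm (inv J x))"
proof -
  have add: "J x + J y = J (x + y)" and diff: "J x - J y = J (x - y)"
    and scale: "a *\<^sub>R J x = J (a *\<^sub>R x)" for a x y
    using J(1) by (simp_all add: linear_add linear_diff linear_scale)
  have inv: "inv J (J x) = x" for x using J(2) by simp
  have zero: "J x = 0 \<longleftrightarrow> x = 0" for x
    using J by (metis linear_0 injD)
  have "\<exists>l\<in>range J. (\<lambda>n. norm (inv J (s n - l))) \<longlonglongrightarrow> 0"
    if s: "range s \<subseteq> range J"
      and c: "\<forall>e>0. \<exists>n0. \<forall>m\<ge>n0. \<forall>n\<ge>n0. norm (inv J (s m - s n)) < e" for s :: "nat \<Rightarrow> 'u"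
  proof -
    have "\<forall>n. \<exists>t. s n = J t" using s by blast
    then obtain t where t: "s = (\<lambda>n. J (t n))" by metis
    have "Cauchy t"
      using c by (simp add: t diff inv Cauchy_def dist_norm)
    then obtain l where "t \<longlonglongrightarrow> l" using Cauchy_convergent convergent_def by blast
    then have "(\<lambda>n. norm (inv J (s n - J l))) \<longlonglongrightarrow> 0"
      by (simp add: t diff inv LIM_zero tendsto_norm_zero)
    then show ?thesis by blast
  qed
  moreover have "subspace (range J)"
    using J(1) linear_subspace_image subspace_UNIV by blast
  ultimately show ?thesis
    unfolding banach_on_def
    by (auto simp: add scale inv zero norm_triangle_ineq)
qed

definition lip0_into ::
  "'a::metric_space \<Rightarrow> 'u::real_vector set \<Rightarrow> ('u \<Rightarrow> real) \<Rightarrow> ('a \<Rightarrow> 'u) set" where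
  "lip0_into x0 V N =
     {S. range S \<subseteq> V \<and> S x0 = 0 \<and> (\<exists>L. \<forall>x y. N (S x - S y) \<le> L * dist x y)}"

definition lip_summing_const ::
  "real \<Rightarrow> 'a::metric_space \<Rightarrow> ('u::real_vector \<Rightarrow> real) \<Rightarrow> ('a \<Rightarrow> 'u) \<Rightarrow> real \<Rightarrow> bool" where
  "lip_summing_const p x0 N S C \<longleftrightarrow> C \<ge> 0 \<and>
     (\<forall>(m::nat) x' x'' w. (\<forall>j<m. w j > 0) \<longrightarrow>
        (\<Sum>j<m. w j powr p * N (S (x' j) - S (x'' j)) powr p) powr (1 / p)
          \<le> C * (SUP f\<in>lip_ball x0.
                   (\<Sum>j<m. w j powr p * \<bar>f (x' j) - f (x'' j)\<bar> powr p) powr (1 / p)))"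

definition lip_summing ::
  "real \<Rightarrow> 'a::metric_space \<Rightarrow> 'u::real_vector set \<Rightarrow> ('u \<Rightarrow> real) \<Rightarrow> ('a \<Rightarrow> 'u) set" where
  "lip_summing p x0 V N = {S \<in> lip0_into x0 V N. \<exists>C. lip_summing_const p x0 N S C}"

definition lip_summing_norm ::
  "real \<Rightarrow> 'a::metric_space \<Rightarrow> ('u::real_vector \<Rightarrow> real) \<Rightarrow> ('a \<Rightarrow> 'u) \<Rightarrow> real" where
  "lip_summing_norm p x0 N S = Inf {C. lip_summing_const p x0 N S C}"

definition abs_summing_const ::
  "real \<Rightarrow> ('u::real_vector \<Rightarrow> real) \<Rightarrow> ('e::real_normed_vector \<Rightarrow> 'u) \<Rightarrow> real \<Rightarrow> bool" where
  "abs_summing_const q N R C \<longleftrightarrow> C \<ge> 0 \<and>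
     (\<forall>(m::nat) x. (\<Sum>j<m. N (R (x j)) powr q) powr (1 / q)
        \<le> C * (SUP \<xi>\<in>cball (0 :: 'e dual) 1.
                 (\<Sum>j<m. \<bar>blinfun_apply \<xi> (x j)\<bar> powr q) powr (1 / q)))"

definition abs_summing ::
  "real \<Rightarrow> 'u::real_vector set \<Rightarrow> ('u \<Rightarrow> real) \<Rightarrow> ('e::real_normed_vector \<Rightarrow> 'u) set" where
  "abs_summing q V N =
     {R. linear R \<and> range R \<subseteq> V \<and> (\<exists>K. \<forall>x. N (R x) \<le> K * norm x) \<and>
         (\<exists>C. abs_summing_const q N R C)}"

definition abs_summing_norm ::
  "real \<Rightarrow> ('u::real_vector \<Rightarrow> real) \<Rightarrow> ('e::real_normed_vector \<Rightarrow> 'u) \<Rightarrow> real" where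
  "abs_summing_norm q N R = Inf {C. abs_summing_const q N R C}"


section \<open>Lipschitz dominated operators\<close>

text \<open>
  \<open>(G, NG)\<close> and \<open>(H, NH)\<close> are the two Banach spaces of the factorization.
\<close>

definition dominating ::
  "real \<Rightarrow> real \<Rightarrow> real \<Rightarrow> real \<Rightarrow> 'a::metric_space \<Rightarrow> ('a \<Rightarrow> 'b::banach) \<Rightarrow>
   'u::real_vector set \<Rightarrow> ('u \<Rightarrow> real) \<Rightarrow> ('a \<Rightarrow> 'u) \<Rightarrow>
   'u set \<Rightarrow> ('u \<Rightarrow> real) \<Rightarrow> ('b dual \<Rightarrow> 'u) \<Rightarrow> real \<Rightarrow> bool" where
  "dominating p \<theta> q \<nu> x0 T G NG S H NH R C \<longleftrightarrow>
     banach_on G NG \<and> banach_on H NH \<and>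
     S \<in> lip_summing p x0 G NG \<and> R \<in> abs_summing q H NH \<and> C > 0 \<and>
     (\<forall>x' x'' b. \<bar>blinfun_apply b (T x' - T x'')\<bar>
        \<le> C * dist x' x'' powr \<theta> * NG (S x' - S x'') powr (1 - \<theta>)
            * norm b powr \<nu> * NH (R b) powr (1 - \<nu>))"

text \<open>
  HOL cannot quantify over types inside a formula, so \<open>G\<close> and \<open>H\<close> range over all Banach
  spaces whose underlying vector space lies in a universe. The factor \<open>'u\<close> is an
  arbitrary real vector space, hence a statement that is polymorphic in \<open>'u\<close> reaches Banach
  spaces of every type. The other two factors are \<open>\<ell>\<^sub>\<infinity>(X)\<close> and \<open>\<ell>\<^sub>\<infinity>(F*)\<close>; they only
  make sure that the universe is never too small, since every metric image of \<open>X\<close> embeds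
  isometrically into the former and every linear image of \<open>F*\<close> isometrically and linearly
  into the latter.
\<close>

type_synonym ('u, 'a, 'b) universe =
  "'u \<times> ('a discrete \<Rightarrow>\<^sub>C real) \<times> ('b dual discrete \<Rightarrow>\<^sub>C real)"

definition lip_dominated ::
  "'u::real_vector itself \<Rightarrow> real \<Rightarrow> real \<Rightarrow> real \<Rightarrow> real \<Rightarrow> 'a::metric_space \<Rightarrow>
   ('a \<Rightarrow> 'b::banach) set" where
  "lip_dominated _ p \<theta> q \<nu> x0 =
     {T \<in> lip0 x0.
        \<exists>(G :: ('u, 'a, 'b) universe set) NG S (H :: ('u, 'a, 'b) universe set) NH R C.
          dominating p \<theta> q \<nu> x0 T G NG S H NH R C}"

definition lip_dominated_norm ::
  "'u::real_vector itself \<Rightarrow> real \<Rightarrow> real \<Rightarrow> real \<Rightarrow> real \<Rightarrow> 'a::metric_space \<Rightarrow>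
   ('a \<Rightarrow> 'b::banach) \<Rightarrow> real" where
  "lip_dominated_norm _ p \<theta> q \<nu> x0 T =
     Inf {C * lip_summing_norm p x0 NG S powr (1 - \<theta>) * abs_summing_norm q NH R powr (1 - \<nu>)
          | (G :: ('u, 'a, 'b) universe set) NG S (H :: ('u, 'a, 'b) universe set) NH R C.
              dominating p \<theta> q \<nu> x0 T G NG S H NH R C}"

definition integral_dominated ::
  "real \<Rightarrow> real \<Rightarrow> real \<Rightarrow> real \<Rightarrow> 'a::metric_space \<Rightarrow> ('a \<Rightarrow> 'b::banach) \<Rightarrow> real \<Rightarrow> bool" where
  "integral_dominated p \<theta> q \<nu> x0 T C \<longleftrightarrow> C \<ge> 0 \<and>
     (\<exists>(\<mu> :: ('a \<Rightarrow> real) measure) (\<tau> :: 'b dual dual measure).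
        regular_borel_prob (lip_ball_topology x0) \<mu> \<and>
        regular_borel_prob dual_ball_topology \<tau> \<and>
        (\<forall>x' x'' b. \<bar>blinfun_apply b (T x' - T x'')\<bar>
           \<le> C * (\<integral>f. (\<bar>f x' - f x''\<bar> powr (1 - \<theta>) * dist x' x'' powr \<theta>)
                        powr (p / (1 - \<theta>)) \<partial>\<mu>) powr ((1 - \<theta>) / p)
               * (\<integral>\<xi>. (\<bar>blinfun_apply \<xi> b\<bar> powr (1 - \<nu>) * norm b powr \<nu>)
                        powr (q / (1 - \<nu>)) \<partial>\<tau>) powr ((1 - \<nu>) / q)))"

definition sequence_dominated ::
  "real \<Rightarrow> real \<Rightarrow> real \<Rightarrow> real \<Rightarrow> real \<Rightarrow> 'a::metric_space \<Rightarrow> ('a \<Rightarrow> 'b::banach) \<Rightarrow> real \<Rightarrow> bool" where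
  "sequence_dominated p \<theta> q \<nu> r' x0 T C \<longleftrightarrow> C \<ge> 0 \<and>
     (\<forall>m x' x'' \<sigma> (b :: nat \<Rightarrow> 'b dual).
        (\<Sum>j<m. \<bar>\<sigma> j * blinfun_apply (b j) (T (x' j) - T (x'' j))\<bar> powr r') powr (1 / r')
          \<le> C * delta_lip p \<theta> x0 m \<sigma> x' x'' * delta_lin q \<nu> m b)"

end

theory Submission
  imports Defs
begin

text \<open>
  The three conditions are proved equivalent in a circle that keeps track of the constants.

  If \<open>T\<close> is dominated by \<open>S\<close> and \<open>R\<close>, then the inequality for finite sequences follows from Hoelder's
  inequality, the exponents being related by \<open>1 / r' = (1 - \<theta>) / p + (1 - \<nu>) / q\<close>, and from the
  summing inequalities of \<open>S\<close> and \<open>R\<close> with suitable weights. The resulting constant is exactly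
  \<open>C * \<pi>(S) powr (1 - \<theta>) * \<pi>(R) powr (1 - \<nu>)\<close> (\<open>dominating_imp_sequence_dominated\<close>).

  The passage from finite sequences to integrals is a domination argument in the style of Pietsch.
  The arithmetic-geometric inequality turns the product of the two suprema into a supremum of sums over
  the product of the two balls, and a Hahn-Banach separation (\<open>mazur_orlicz\<close>,
  \<open>mean_separating_cone\<close>) yields a mean, that is, a normalized positive functional, on the bounded
  functions of this product, with marginals that satisfy the integral inequality
  (\<open>bilinear_domination_by_means\<close>). Both balls are compact Hausdorff spaces, in general not metrizable. A
  mean on such a space is bounded, on nonnegative continuous functions, by the integral with respect to a
  regular Borel probability measure (\<open>mean_below_regular_borel_prob\<close>): the finitely additive
  measure given by the mean is regularized by measuring open sets from inside and all sets from outside.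
  The constant does not change.

  Conversely, let measures \<open>\<mu>\<close> and \<open>\<tau>\<close> be given. The canonical maps from \<open>X\<close> to \<open>L\<^sub>p (\<mu>)\<close> and from \<open>F*\<close> to
  \<open>L\<^sub>q (\<tau>)\<close> are summing with constant at most one and dominate \<open>T\<close>. The first enters only through the distances
  between its values and the second only through the seminorm it induces, so \<open>L\<^sub>p (\<mu>)\<close> and \<open>L\<^sub>q (\<tau>)\<close> can be
  replaced by the spaces of bounded functions on \<open>X\<close> and on \<open>F*\<close> (\<open>sup_distance_embedding\<close>,
  \<open>seminorm_embedding\<close>).

  Hence every value entering the infimum that defines the domination norm is a constant for the
  inequality of sequences, every such constant is one for the inequality of integrals, and if \<open>C\<close> is
  one of the latter and \<open>C' \<ge> C\<close> is positive, then some value is at most \<open>C'\<close>. So the three infima agree.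
\<close>

section \<open>Sublinear functionals and the theorem of Mazur and Orlicz\<close>

text \<open>
  Positive homogeneity is only demanded as an inequality. Applying it to \<open>t\<close> and to \<open>1 / t\<close>
  gives equality, and \<open>P 0 = 0\<close> follows from \<open>t = 2\<close> and \<open>t = 1/2\<close>. For an infimum of
  sublinear functionals the inequality is all that has to be checked.
\<close>

definition sublinear :: "('v::real_vector \<Rightarrow> real) \<Rightarrow> bool" where
  "sublinear P \<longleftrightarrow> (\<forall>x y. P (x + y) \<le> P x + P y) \<and> (\<forall>t x. t > 0 \<longrightarrow> P (t *\<^sub>R x) \<le> t * P x)"

lemma sublinearD:
  assumes "sublinear P"
  shows "P (x + y) \<le> P x + P y" and "t > 0 \<Longrightarrow> P (t *\<^sub>R x) = t * P x" and "P 0 = 0" and "- P (- x) \<le> P x"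
proof -
  have *: "P (t *\<^sub>R x) \<le> t * P x" if "t > 0" for t x
    using assms that by (auto simp: sublinear_def)
  show add: "P (x + y) \<le> P x + P y" for x y using assms by (auto simp: sublinear_def)
  show "P (t *\<^sub>R x) = t * P x" if "t > 0"
    using *[of t x] *[of "1 / t" "t *\<^sub>R x"] that by (simp add: field_simps)
  show 0: "P 0 = 0"
    using *[of 2 0] *[of "1/2" 0] by simp
  show "- P (- x) \<le> P x" using add[of x "- x"] 0 by simp
qed

text \<open>
  The functional \<open>Q x = inf P (x + \<psi>) - c\<close> over the pairs \<open>(\<psi>, c)\<close> of the cone is the largest
  sublinear minorant of \<open>P\<close> with \<open>Q (- \<psi>) \<le> - c\<close>; the condition \<open>c \<le> P \<psi>\<close> on the cone is what keeps
  the infimum finite. A linear functional below \<open>Q\<close> then takes values at least \<open>c\<close> at \<open>\<psi>\<close>.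
\<close>

lemma sublinear_infimum_over_cone:
  fixes P :: "'v::real_vector \<Rightarrow> real" and \<Psi> :: "('v \<times> real) set"
  assumes P: "sublinear P" and zero: "0 \<in> \<Psi>"
    and add: "\<And>a b. a \<in> \<Psi> \<Longrightarrow> b \<in> \<Psi> \<Longrightarrow> a + b \<in> \<Psi>"
    and scale: "\<And>t a. t > 0 \<Longrightarrow> a \<in> \<Psi> \<Longrightarrow> t *\<^sub>R a \<in> \<Psi>"
    and le: "\<And>\<psi> c. (\<psi>, c) \<in> \<Psi> \<Longrightarrow> c \<le> P \<psi>"
  obtains Q where "sublinear Q" "\<And>x. Q x \<le> P x" "\<And>\<psi> c. (\<psi>, c) \<in> \<Psi> \<Longrightarrow> Q (- \<psi>) \<le> - c"
proof
  define Q where "Q x = (INF a\<in>\<Psi>. P (x + fst a) - snd a)" for x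
  have "- P (- x) \<le> P (x + fst a) - snd a" if "a \<in> \<Psi>" for x a
    using le[of "fst a" "snd a"] sublinearD(1)[OF P, of "x + fst a" "- x"] that by simp
  then have bdd: "bdd_below ((\<lambda>a. P (x + fst a) - snd a) ` \<Psi>)" for x
    by (intro bdd_belowI2)
  have Q_le: "Q x \<le> P (x + fst a) - snd a" if "a \<in> \<Psi>" for x a
    unfolding Q_def by (intro cINF_lower bdd that)
  have Q_ge: "z \<le> Q x" if "\<And>a. a \<in> \<Psi> \<Longrightarrow> z \<le> P (x + fst a) - snd a" for z x
    unfolding Q_def using zero that by (intro cINF_greatest) auto
  show "sublinear Q"
    unfolding sublinear_def
  proof (intro conjI allI impI)
    fix x y
    have "Q (x + y) - Q y \<le> P (x + fst a) - snd a" if a: "a \<in> \<Psi>" for a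
    proof -
      have "Q (x + y) - (P (x + fst a) - snd a) \<le> P (y + fst b) - snd b" if b: "b \<in> \<Psi>" for b
        using Q_le[OF add[OF a b], of "x + y"] sublinearD(1)[OF P, of "x + fst a" "y + fst b"]
        by (simp add: algebra_simps)
      then show ?thesis using Q_ge[of "Q (x + y) - (P (x + fst a) - snd a)" y] by simp
    qed
    then show "Q (x + y) \<le> Q x + Q y" using Q_ge[of "Q (x + y) - Q y" x] by simp
  next
    fix t :: real and x :: 'v assume t: "t > 0"
    have "Q (t *\<^sub>R x) / t \<le> P (x + fst a) - snd a" if a: "a \<in> \<Psi>" for a
      using Q_le[OF scale[OF t a], of "t *\<^sub>R x"] sublinearD(2)[OF P t, of "x + fst a"] t
      by (simp add: field_simps scaleR_add_right)
    then show "Q (t *\<^sub>R x) \<le> t * Q x" using Q_ge[of "Q (t *\<^sub>R x) / t" x] t by (simp add: field_simps)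
  qed
  show "Q x \<le> P x" for x using Q_le[OF zero, of x] by simp
  show "Q (- \<psi>) \<le> - c" if "(\<psi>, c) \<in> \<Psi>" for \<psi> c
    using Q_le[OF that, of "- \<psi>"] sublinearD(3)[OF P] by simp
qed

text \<open>
  Zorn's lemma, downwards: the pointwise infimum of a chain of sublinear functionals below \<open>P\<close>
  is finite, since each of them is at least \<open>- P (- x)\<close> at \<open>x\<close>, and it is again sublinear because any
  two members of the chain are comparable.
\<close>

lemma minimal_sublinear_exists:
  fixes P :: "'v::real_vector \<Rightarrow> real"
  assumes P: "sublinear P"
  obtains L where "sublinear L" "L \<le> P" "\<And>Q. sublinear Q \<Longrightarrow> Q \<le> L \<Longrightarrow> Q = L"
proof -
  let ?A = "{Q. sublinear Q \<and> Q \<le> P}"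
  have "\<exists>m\<in>?A. \<forall>a\<in>?A. m \<ge> a \<longrightarrow> a = m"
  proof (rule predicate_Zorn)
    show "partial_order_on ?A (relation_of (\<ge>) ?A)"
      by (rule partial_order_on_relation_ofI) auto
    fix C assume C: "C \<in> Chains (relation_of (\<ge>) ?A)"
    have sub: "sublinear Q" "Q \<le> P" if "Q \<in> C" for Q
      using C that by (auto simp: Chains_def relation_of_def)
    have total: "Q \<le> Q' \<or> Q' \<le> Q" if "Q \<in> C" "Q' \<in> C" for Q Q'
      using C that by (auto simp: Chains_def relation_of_def)
    show "\<exists>u\<in>?A. \<forall>a\<in>C. u \<le> a"
    proof (cases "C = {}")
      case True
      then show ?thesis using P by auto
    next
      case False
      define U where "U x = (INF Q\<in>C. Q x)" for x
      have "- P (- x) \<le> Q x" if "Q \<in> C" for Q x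
        using sublinearD(4)[OF sub(1)[OF that], of x] sub(2)[OF that] by (metis le_funD neg_le_iff_le order_trans)
      then have bdd: "bdd_below ((\<lambda>Q. Q x) ` C)" for x by (auto simp: bdd_below_def)
      have U_le: "U x \<le> Q x" if "Q \<in> C" for x Q unfolding U_def by (intro cINF_lower bdd that)
      have U_ge: "z \<le> U x" if "\<And>Q. Q \<in> C \<Longrightarrow> z \<le> Q x" for z x
        unfolding U_def using False that by (intro cINF_greatest) auto
      have "sublinear U" unfolding sublinear_def
      proof (intro conjI allI impI)
        fix x y
        have "U (x + y) - U y \<le> Q x" if Q: "Q \<in> C" for Q
        proof -
          have "U (x + y) - Q x \<le> Q' y" if Q': "Q' \<in> C" for Q'
          proof (cases "Q \<le> Q'")
            case True
            then show ?thesis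
              using U_le[OF Q, of "x + y"] sublinearD(1)[OF sub(1)[OF Q], of x y] le_funD[OF True, of y] by simp
          next
            case False
            then have "Q' \<le> Q" using total Q Q' by blast
            then show ?thesis
              using U_le[OF Q', of "x + y"] sublinearD(1)[OF sub(1)[OF Q'], of x y] le_funD[of Q' Q x] by simp
          qed
          then show ?thesis using U_ge[of "U (x + y) - Q x" y] by simp
        qed
        then show "U (x + y) \<le> U x + U y" using U_ge[of "U (x + y) - U y" x] by simp
      next
        fix t :: real and x :: 'v assume t: "t > 0"
        have "U (t *\<^sub>R x) / t \<le> Q x" if Q: "Q \<in> C" for Q
          using U_le[OF Q, of "t *\<^sub>R x"] sublinearD(2)[OF sub(1)[OF Q] t, of x] t by (simp add: field_simps)
        then show "U (t *\<^sub>R x) \<le> t * U x" using U_ge[of "U (t *\<^sub>R x) / t" x] t by (simp add: field_simps)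
      qed
      moreover have "U \<le> P" using False U_le sub(2) by (metis all_not_in_conv le_fun_def order_trans)
      ultimately show ?thesis using U_le by (auto simp: le_fun_def)
    qed
  qed
  then obtain L where "sublinear L" "L \<le> P" "\<forall>a\<in>?A. a \<le> L \<longrightarrow> a = L" by auto
  then show thesis using that by (metis (mono_tags, lifting) mem_Collect_eq order_trans)
qed

text \<open>
  A ray \<open>t \<mapsto> t (a, P a)\<close> is the simplest cone to which the infimum construction applies. It is
  used to force a functional below \<open>P\<close> to be large at a single vector.
\<close>

lemma ray_in_product_cone:
  fixes a :: "'v::real_vector" and s :: real
  defines "\<Psi> \<equiv> {(t *\<^sub>R a, t * s) | t. t \<ge> 0}"
  shows "0 \<in> \<Psi>" and "u \<in> \<Psi> \<Longrightarrow> v \<in> \<Psi> \<Longrightarrow> u + v \<in> \<Psi>" and "c > 0 \<Longrightarrow> u \<in> \<Psi> \<Longrightarrow> c *\<^sub>R u \<in> \<Psi>"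
proof -
  show "0 \<in> \<Psi>" by (auto simp: \<Psi>_def zero_prod_def)
  show "u + v \<in> \<Psi>" if "u \<in> \<Psi>" "v \<in> \<Psi>"
  proof -
    obtain b t where "u = (b *\<^sub>R a, b * s)" "v = (t *\<^sub>R a, t * s)" "b \<ge> 0" "t \<ge> 0"
      using \<open>u \<in> \<Psi>\<close> \<open>v \<in> \<Psi>\<close> by (auto simp: \<Psi>_def)
    then show ?thesis by (auto simp: \<Psi>_def algebra_simps intro!: exI[of _ "b + t"])
  qed
  show "c *\<^sub>R u \<in> \<Psi>" if "c > 0" "u \<in> \<Psi>"
  proof -
    obtain t where "u = (t *\<^sub>R a, t * s)" "t \<ge> 0" using \<open>u \<in> \<Psi>\<close> by (auto simp: \<Psi>_def)
    then show ?thesis using \<open>c > 0\<close> by (auto simp: \<Psi>_def intro!: exI[of _ "c * t"])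
  qed
qed

lemma sublinear_on_ray:
  assumes "sublinear P" "(\<psi>, c) \<in> {(t *\<^sub>R a, t * P a) | t. t \<ge> 0}"
  shows "c \<le> P \<psi>"
proof -
  obtain t where "\<psi> = t *\<^sub>R a" "c = t * P a" "t \<ge> 0" using assms(2) by auto
  then show ?thesis using sublinearD(2,3)[OF assms(1)] by (cases "t = 0") auto
qed

text \<open>
  The Hahn-Banach theorem. A minimal sublinear functional \<open>L\<close> is odd: the infimum construction
  over the ray through \<open>(a, L a)\<close> yields a sublinear functional below \<open>L\<close>, hence \<open>L\<close> itself, and the
  construction gives it the value at most \<open>- L a\<close> at \<open>- a\<close>. An odd sublinear functional is linear.
\<close>

lemma linear_below_sublinear:
  fixes P :: "'v::real_vector \<Rightarrow> real"
  assumes P: "sublinear P"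
  obtains L where "linear L" "\<And>x. L x \<le> P x"
proof -
  obtain L where L: "sublinear L" "L \<le> P" and min: "\<And>Q. sublinear Q \<Longrightarrow> Q \<le> L \<Longrightarrow> Q = L"
    using minimal_sublinear_exists[OF P] by blast
  have odd: "L (- a) = - L a" for a
  proof -
    let ?\<Psi> = "{(t *\<^sub>R a, t * L a) | t. t \<ge> 0}"
    have "\<exists>Q. sublinear Q \<and> (\<forall>x. Q x \<le> L x) \<and> (\<forall>\<psi> c. (\<psi>, c) \<in> ?\<Psi> \<longrightarrow> Q (- \<psi>) \<le> - c)"
      by (rule sublinear_infimum_over_cone[OF L(1) ray_in_product_cone[where a = a and s = "L a"]])
        (use sublinear_on_ray[OF L(1), of _ _ a] in blast)+
    then obtain Q where Q: "sublinear Q" "\<forall>x. Q x \<le> L x" "\<forall>\<psi> c. (\<psi>, c) \<in> ?\<Psi> \<longrightarrow> Q (- \<psi>) \<le> - c"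
      by blast
    moreover have "(a, L a) \<in> ?\<Psi>" by (auto intro!: exI[of _ 1])
    ultimately have "Q (- a) \<le> - L a" by blast
    moreover have "Q = L" using Q by (intro min) (auto simp: le_fun_def)
    ultimately show ?thesis using sublinearD(4)[OF L(1), of a] by simp
  qed
  have "linear L"
  proof
    show "L (x + y) = L x + L y" for x y
      using sublinearD(1)[OF L(1), of x y] sublinearD(1)[OF L(1), of "x + y" "- y"] odd[of y] by simp
    show "L (t *\<^sub>R x) = t *\<^sub>R L x" for t x
    proof -
      consider "t = 0" | "t > 0" | "- t > 0" by linarith
      then show ?thesis
      proof cases
        case 1
        then show ?thesis using sublinearD(3)[OF L(1)] by simp
      next
        case 2
        then show ?thesis using sublinearD(2)[OF L(1)] by simp
      next
        case 3
        then show ?thesis using sublinearD(2)[OF L(1) 3, of x] odd[of "t *\<^sub>R x"] by simp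
      qed
    qed
  qed
  then show thesis using that L(2) by (auto simp: le_fun_def)
qed

text \<open>
  The theorem of Mazur and Orlicz. Its two uses below are different: with a cone of functions and
  \<open>c = 0\<close> it separates, and with a single ray it produces a norming functional of a seminorm.
\<close>

theorem mazur_orlicz:
  fixes P :: "'v::real_vector \<Rightarrow> real" and \<Psi> :: "('v \<times> real) set"
  assumes P: "sublinear P" and zero: "0 \<in> \<Psi>"
    and add: "\<And>a b. a \<in> \<Psi> \<Longrightarrow> b \<in> \<Psi> \<Longrightarrow> a + b \<in> \<Psi>"
    and scale: "\<And>t a. t > 0 \<Longrightarrow> a \<in> \<Psi> \<Longrightarrow> t *\<^sub>R a \<in> \<Psi>"
    and le: "\<And>\<psi> c. (\<psi>, c) \<in> \<Psi> \<Longrightarrow> c \<le> P \<psi>"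
  obtains L where "linear L" "\<And>x. L x \<le> P x" "\<And>\<psi> c. (\<psi>, c) \<in> \<Psi> \<Longrightarrow> c \<le> L \<psi>"
proof -
  obtain Q where Q: "sublinear Q" "\<And>x. Q x \<le> P x" "\<And>\<psi> c. (\<psi>, c) \<in> \<Psi> \<Longrightarrow> Q (- \<psi>) \<le> - c"
    using sublinear_infimum_over_cone[OF assms] by blast
  obtain L where L: "linear L" "\<And>x. L x \<le> Q x" using linear_below_sublinear[OF Q(1)] by blast
  have "c \<le> L \<psi>" if "(\<psi>, c) \<in> \<Psi>" for \<psi> c
    using L(2)[of "- \<psi>"] Q(3)[OF that] linear_neg[OF L(1), of \<psi>] by simp
  then show thesis using that L Q(2) by (meson order_trans)
qed

section \<open>Regular Borel measures from finitely additive ones\<close>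

text \<open>
  Normality provides an open \<open>W\<close> between \<open>C - V\<close> and \<open>U\<close> with closure inside \<open>U\<close>. The two pieces
  are cut out of \<open>C\<close> by the closure of \<open>W\<close> and by the complement of \<open>W\<close>.
\<close>

lemma compact_Hausdorff_cover_split:
  assumes Y: "compact_space Y" "Hausdorff_space Y"
    and "closedin Y C" "openin Y U" "openin Y V" "C \<subseteq> U \<union> V"
  obtains C1 C2 where "closedin Y C1" "closedin Y C2" "C1 \<subseteq> U" "C2 \<subseteq> V" "C = C1 \<union> C2"
proof -
  have "normal_space Y"
    using Y compact_Hausdorff_or_regular_imp_normal_space by blast
  moreover have "closedin Y (C - V)" "C - V \<subseteq> U" using assms by auto
  ultimately obtain W where W: "openin Y W" "C - V \<subseteq> W" "Y closure_of W \<subseteq> U"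
    using \<open>openin Y U\<close> unfolding normal_space_alt by metis
  show thesis
  proof
    show "closedin Y (C \<inter> Y closure_of W)" "closedin Y (C - W)" using assms W by auto
    show "C \<inter> Y closure_of W \<subseteq> U" "C - W \<subseteq> V" using W by auto
    show "C = C \<inter> Y closure_of W \<union> (C - W)"
      using closure_of_subset[OF openin_subset[OF W(1)]] by auto
  qed
qed

text \<open>
  A finitely additive probability \<open>m\<close> on all subsets of a compact Hausdorff space is turned into
  a regular Borel measure. Open sets are measured from inside by the closed sets that they contain,
  arbitrary sets from outside by open sets. Finite additivity becomes countable additivity because
  a closed subset of a countable union of open sets is covered by finitely many of them. In general
  the new measure does not extend \<open>m\<close>, but it can only be larger on closed sets, which is the
  direction needed for upper bounds by integrals.
\<close>

locale content =
  fixes Y :: "'c topology" and m :: "'c set \<Rightarrow> ennreal"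
  assumes compact: "compact_space Y" and Hausdorff: "Hausdorff_space Y"
    and m_Un: "\<And>A B. A \<subseteq> topspace Y \<Longrightarrow> B \<subseteq> topspace Y \<Longrightarrow> A \<inter> B = {} \<Longrightarrow> m (A \<union> B) = m A + m B"
    and m_space: "m (topspace Y) = 1"
begin

definition inner_content :: "'c set \<Rightarrow> ennreal" where
  "inner_content U = (SUP C\<in>{C. closedin Y C \<and> C \<subseteq> U}. m C)"

definition outer_content :: "'c set \<Rightarrow> ennreal" where
  "outer_content A = (INF U\<in>{U. openin Y U \<and> A \<subseteq> U}. inner_content U)"

lemma m_mono:
  assumes "A \<subseteq> B" "B \<subseteq> topspace Y"
  shows "m A \<le> m B"
proof -
  have "m (A \<union> (B - A)) = m A + m (B - A)" using assms by (intro m_Un) auto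
  then show ?thesis using assms(1) by (simp add: Un_absorb1)
qed

lemma m_empty: "m {} = 0"
  using m_Un[of "topspace Y" "{}"] m_space by (simp add: ennreal_add_left_cancel)

lemma m_Un_le:
  assumes "A \<subseteq> topspace Y" "B \<subseteq> topspace Y"
  shows "m (A \<union> B) \<le> m A + m B"
proof -
  have "m (A \<union> (B - A)) = m A + m (B - A)" using assms by (intro m_Un) auto
  also have "\<dots> \<le> m A + m B" using assms by (intro add_left_mono m_mono) auto
  finally show ?thesis by simp
qed

lemma m_le_inner: "closedin Y C \<Longrightarrow> C \<subseteq> U \<Longrightarrow> m C \<le> inner_content U"
  unfolding inner_content_def by (intro SUP_upper) auto

lemma inner_mono: "U \<subseteq> V \<Longrightarrow> inner_content U \<le> inner_content V"
  unfolding inner_content_def by (intro SUP_subset_mono) auto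

lemma inner_space: "inner_content (topspace Y) = 1"
proof (rule antisym)
  show "inner_content (topspace Y) \<le> 1"
    unfolding inner_content_def m_space[symmetric] by (intro SUP_least m_mono) auto
  show "1 \<le> inner_content (topspace Y)"
    using m_le_inner[of "topspace Y" "topspace Y"] m_space by simp
qed

lemma inner_empty: "inner_content {} = 0"
  unfolding inner_content_def using m_empty by (intro antisym SUP_least) auto

text \<open>
  A closed set covered by finitely many open sets splits into closed pieces, one inside each of
  them.
\<close>

lemma inner_finite_subadditive:
  assumes "finite F" "\<And>i. i \<in> F \<Longrightarrow> openin Y (U i)" "closedin Y C" "C \<subseteq> (\<Union>i\<in>F. U i)"
  shows "m C \<le> (\<Sum>i\<in>F. inner_content (U i))"
  using assms
proof (induction F arbitrary: C rule: finite_induct)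
  case empty
  then show ?case using m_empty by simp
next
  case (insert i F)
  have "openin Y (U i)" "openin Y (\<Union>i\<in>F. U i)" "C \<subseteq> U i \<union> (\<Union>i\<in>F. U i)"
    using insert.prems by auto
  then obtain C1 C2 where C: "closedin Y C1" "closedin Y C2" "C1 \<subseteq> U i" "C2 \<subseteq> (\<Union>i\<in>F. U i)" "C = C1 \<union> C2"
    using compact_Hausdorff_cover_split[OF compact Hausdorff insert.prems(2)] by metis
  have "m C \<le> m C1 + m C2" using C closedin_subset m_Un_le by metis
  also have "\<dots> \<le> inner_content (U i) + (\<Sum>i\<in>F. inner_content (U i))"
    using m_le_inner[OF C(1,3)] insert.IH[OF _ C(2,4)] insert.prems(1) by (intro add_mono) auto
  finally show ?case using insert.hyps by simp
qed

lemma inner_countably_subadditive: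
  assumes U: "\<And>i::nat. openin Y (U i)"
  shows "inner_content (\<Union>i. U i) \<le> (\<Sum>i. inner_content (U i))"
  unfolding inner_content_def[of "\<Union>i. U i"]
proof (rule SUP_least, clarify)
  fix C assume C: "closedin Y C" "C \<subseteq> (\<Union>i. U i)"
  then have "compactin Y C" using compact closedin_compact_space by blast
  moreover have "\<And>u. u \<in> range U \<Longrightarrow> openin Y u" using U by blast
  ultimately obtain \<F> where "finite \<F>" "\<F> \<subseteq> range U" "C \<subseteq> \<Union>\<F>"
    using C(2) compactinD by metis
  then obtain F where F: "finite F" "C \<subseteq> (\<Union>i\<in>F. U i)"
    by (metis finite_subset_image)
  have "m C \<le> (\<Sum>i\<in>F. inner_content (U i))"
    using inner_finite_subadditive[OF F(1) U C(1) F(2)] .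
  also have "\<dots> \<le> (\<Sum>i. inner_content (U i))" using F(1) by (intro sum_le_suminf) auto
  finally show "m C \<le> (\<Sum>i. inner_content (U i))" .
qed

lemma outer_le_inner: "openin Y U \<Longrightarrow> A \<subseteq> U \<Longrightarrow> outer_content A \<le> inner_content U"
  unfolding outer_content_def by (intro INF_lower) auto

lemma outer_open: "openin Y U \<Longrightarrow> outer_content U = inner_content U"
  by (intro antisym outer_le_inner) (auto simp: outer_content_def intro!: INF_greatest inner_mono)

lemma outer_mono: "A \<subseteq> B \<Longrightarrow> outer_content A \<le> outer_content B"
  unfolding outer_content_def by (intro INF_superset_mono) auto

lemma outer_finite: "A \<subseteq> topspace Y \<Longrightarrow> outer_content A \<noteq> \<infinity>"
  using outer_le_inner[of "topspace Y" A] inner_space by (auto simp: top_unique)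

lemma m_le_outer: "closedin Y C \<Longrightarrow> m C \<le> outer_content C"
  unfolding outer_content_def by (intro INF_greatest m_le_inner) auto

lemma outer_measure_space: "outer_measure_space (Pow (topspace Y)) outer_content"
  unfolding outer_measure_space_def
proof (intro conjI)
  show "positive (Pow (topspace Y)) outer_content"
    using outer_open[of "{}"] inner_empty by (simp add: positive_def)
  show "increasing (Pow (topspace Y)) outer_content" by (simp add: increasing_def outer_mono)
  show "countably_subadditive (Pow (topspace Y)) outer_content"
    unfolding countably_subadditive_def
  proof (intro allI impI)
    fix A :: "nat \<Rightarrow> 'c set" assume A: "range A \<subseteq> Pow (topspace Y)"
    show "outer_content (\<Union>i. A i) \<le> (\<Sum>i. outer_content (A i))"
    proof (rule ennreal_le_epsilon)
      fix e :: real assume e: "0 < e"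
      have "\<exists>U. openin Y U \<and> A n \<subseteq> U \<and> inner_content U \<le> outer_content (A n) + ennreal (e * (1/2)^Suc n)" for n
      proof -
        have "\<exists>U\<in>{U. openin Y U \<and> A n \<subseteq> U}. inner_content U < outer_content (A n) + ennreal (e * (1/2)^Suc n)"
          using e A outer_finite[of "A n"] by (intro INF_approx_ennreal) (auto simp: outer_content_def[symmetric] dest: outer_finite)
        then show ?thesis by (auto intro: less_imp_le)
      qed
      then obtain U where U: "\<And>n. openin Y (U n)" "\<And>n. A n \<subseteq> U n"
          "\<And>n. inner_content (U n) \<le> outer_content (A n) + ennreal (e * (1/2)^Suc n)" by metis
      have "outer_content (\<Union>i. A i) \<le> inner_content (\<Union>i. U i)" using U by (intro outer_le_inner) blast+
      also have "\<dots> \<le> (\<Sum>i. inner_content (U i))" using U inner_countably_subadditive by blast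
      also have "\<dots> \<le> (\<Sum>i. outer_content (A i) + ennreal (e * (1/2)^Suc i))" by (intro suminf_le U) auto
      also have "\<dots> = (\<Sum>i. outer_content (A i)) + (\<Sum>i. ennreal (e * (1/2)^Suc i))" by (intro suminf_add[symmetric]) auto
      also have "(\<Sum>i. ennreal (e * (1/2)^Suc i)) = ennreal e"
        using e sums_mult[OF power_half_series, of e] by (intro suminf_ennreal_eq) auto
      finally show "outer_content (\<Union>i. A i) \<le> (\<Sum>i. outer_content (A i)) + ennreal e" .
    qed
  qed
qed

text \<open>
  Caratheodory measurability of an open \<open>U\<close> has to be tested only against open \<open>V\<close>. If \<open>C\<close> is a
  closed part of \<open>V \<inter> U\<close> and \<open>D\<close> a closed part of the open set \<open>V - C\<close>, then \<open>C\<close> and \<open>D\<close> are disjoint closed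
  parts of \<open>V\<close>, so \<open>m C + m D\<close> is bounded by the content of \<open>V\<close>; then take suprema over \<open>D\<close> and over \<open>C\<close>.
\<close>

lemma open_in_lambda_system:
  assumes U: "openin Y U"
  shows "U \<in> lambda_system (topspace Y) (Pow (topspace Y)) outer_content"
proof -
  have "outer_content (X \<inter> U) + outer_content (X - U) = outer_content X" if X: "X \<subseteq> topspace Y" for X
  proof (rule antisym)
    have "outer_content ((X \<inter> U) \<union> (X - U)) \<le> outer_content (X \<inter> U) + outer_content (X - U)"
      using outer_measure_space X
      by (intro subadditiveD[OF ring_of_sets.countably_subadditive_subadditive[OF ring_of_sets_Pow]])
        (auto simp: outer_measure_space_def)
    then show "outer_content X \<le> outer_content (X \<inter> U) + outer_content (X - U)" by (simp add: Int_Diff_Un)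
    show "outer_content (X \<inter> U) + outer_content (X - U) \<le> outer_content X"
      unfolding outer_content_def[of X]
    proof (rule INF_greatest, clarify)
      fix V assume V: "openin Y V" "X \<subseteq> V"
      have "m C + outer_content (X - U) \<le> inner_content V" if C: "closedin Y C" "C \<subseteq> V \<inter> U" for C
      proof -
        have "m C + m D \<le> inner_content V" if D: "closedin Y D" "D \<subseteq> V - C" for D
        proof -
          have "m (C \<union> D) = m C + m D" using C D closedin_subset by (intro m_Un) auto
          moreover have "m (C \<union> D) \<le> inner_content V" using C D by (intro m_le_inner) auto
          ultimately show ?thesis by simp
        qed
        then have "m C + inner_content (V - C) \<le> inner_content V"
          unfolding inner_content_def[of "V - C"]
          by (subst ennreal_SUP_add_right) (auto intro!: SUP_least)
        moreover have "outer_content (X - U) \<le> inner_content (V - C)"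
          using C V by (intro outer_le_inner) auto
        ultimately show ?thesis by (meson add_left_mono order_trans)
      qed
      then have "inner_content (V \<inter> U) + outer_content (X - U) \<le> inner_content V"
        unfolding inner_content_def[of "V \<inter> U"] by (subst ennreal_SUP_add_left[symmetric]) (auto intro!: SUP_least)
      moreover have "outer_content (X \<inter> U) \<le> inner_content (V \<inter> U)" using U V by (intro outer_le_inner) auto
      ultimately show "outer_content (X \<inter> U) + outer_content (X - U) \<le> inner_content V" by (meson add_right_mono order_trans)
    qed
  qed
  then show ?thesis
    using U openin_subset by (auto simp: algebra.lambda_system_eq[OF algebra_Pow])
qed

definition borel_ext :: "'c measure" where
  "borel_ext = measure_of (topspace Y) {U. openin Y U} outer_content"

lemma borel_ext_basic:
  shows "space borel_ext = topspace Y"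
    and "sets borel_ext = sigma_sets (topspace Y) {U. openin Y U}"
    and "A \<in> sets borel_ext \<Longrightarrow> emeasure borel_ext A = outer_content A"
proof -
  let ?L = "lambda_system (topspace Y) (Pow (topspace Y)) outer_content"
  have sub: "{U. openin Y U} \<subseteq> Pow (topspace Y)" using openin_subset by blast
  then show sp: "space borel_ext = topspace Y"
    and st: "sets borel_ext = sigma_sets (topspace Y) {U. openin Y U}"
    by (auto simp: borel_ext_def space_measure_of_conv)
  have L: "measure_space (topspace Y) ?L outer_content"
    by (rule sigma_algebra.caratheodory_lemma[OF sigma_algebra_Pow outer_measure_space])
  then have "sigma_sets (topspace Y) {U. openin Y U} \<subseteq> ?L"
    by (intro sigma_algebra.sigma_sets_subset) (auto simp: measure_space_def open_in_lambda_system)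
  then have "measure_space (topspace Y) (sigma_sets (topspace Y) {U. openin Y U}) outer_content"
    by (intro measure_down[OF L] sigma_algebra_sigma_sets sub)
  then show "emeasure borel_ext A = outer_content A" if "A \<in> sets borel_ext"
    using that unfolding st
    by (auto simp: measure_space_def intro!: emeasure_measure_of[OF borel_ext_def sub] simp: st)
qed

lemma open_in_borel_ext: "openin Y U \<Longrightarrow> U \<in> sets borel_ext"
  by (simp add: borel_ext_basic)

lemma closed_in_borel_ext: "closedin Y C \<Longrightarrow> C \<in> sets borel_ext"
  using sets.compl_sets[OF open_in_borel_ext, of "topspace Y - C"] closedin_subset[of Y C]
  by (auto simp: borel_ext_basic(1) double_diff openin_diff)

text \<open>
  Outer regularity is built into the construction. Inner regularity is outer regularity of the
  complement, since the complement of an open set is closed and hence compact.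
\<close>

lemma regular_borel_ext: "regular_borel_prob Y borel_ext"
proof -
  have "emeasure borel_ext (space borel_ext) = 1"
    using borel_ext_basic(1,3) open_in_borel_ext[of "topspace Y"] outer_open[of "topspace Y"] inner_space by simp
  then interpret prob_space borel_ext by (rule prob_spaceI)
  have out: "emeasure borel_ext A = (INF U\<in>{U. openin Y U \<and> A \<subseteq> U}. emeasure borel_ext U)"
    if "A \<in> sets borel_ext" for A
    unfolding borel_ext_basic(3)[OF that] outer_content_def
    by (intro INF_cong) (auto simp: borel_ext_basic(3) open_in_borel_ext outer_open[unfolded outer_content_def] outer_open)
  have "emeasure borel_ext A = (SUP K\<in>{K. compactin Y K \<and> K \<subseteq> A}. emeasure borel_ext K)"
    if A: "A \<in> sets borel_ext" for A
  proof (rule antisym)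
    show "emeasure borel_ext A \<le> (SUP K\<in>{K. compactin Y K \<and> K \<subseteq> A}. emeasure borel_ext K)"
    proof (rule ennreal_le_epsilon)
      fix e :: real assume e: "0 < e"
      have Asub: "A \<subseteq> topspace Y" using A sets.sets_into_space borel_ext_basic(1) by blast
      have co: "space borel_ext - A \<in> sets borel_ext" using A by blast
      have "\<exists>U\<in>{U. openin Y U \<and> space borel_ext - A \<subseteq> U}. emeasure borel_ext U < emeasure borel_ext (space borel_ext - A) + ennreal e"
        using e out[OF co] by (intro INF_approx_ennreal) (auto simp: emeasure_eq_measure borel_ext_basic(1) intro!: exI[of _ "topspace Y"])
      then obtain U where U: "openin Y U" "space borel_ext - A \<subseteq> U"
        "emeasure borel_ext U < emeasure borel_ext (space borel_ext - A) + ennreal e" by blast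
      let ?K = "topspace Y - U"
      have K: "compactin Y ?K" "?K \<subseteq> A" "?K \<in> sets borel_ext"
        using U closedin_compact_space[OF compact, of ?K] borel_ext_basic(1)
        by (auto intro!: closed_in_borel_ext openin_closedin_eq[THEN iffD1, THEN conjunct2])
      have "measure borel_ext U \<le> measure borel_ext (space borel_ext - A) + e"
        using U(3) e by (simp add: emeasure_eq_measure ennreal_less_iff flip: ennreal_plus)
      then have "measure borel_ext A \<le> measure borel_ext ?K + e"
        using prob_compl[OF A] prob_compl[OF open_in_borel_ext[OF U(1)]] borel_ext_basic(1) by simp
      then have "emeasure borel_ext A \<le> emeasure borel_ext ?K + ennreal e"
        using e by (simp add: emeasure_eq_measure flip: ennreal_plus)
      also have "\<dots> \<le> (SUP K\<in>{K. compactin Y K \<and> K \<subseteq> A}. emeasure borel_ext K) + ennreal e"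
        using K by (intro add_right_mono SUP_upper) auto
      finally show "emeasure borel_ext A \<le> (SUP K\<in>{K. compactin Y K \<and> K \<subseteq> A}. emeasure borel_ext K) + ennreal e" .
    qed
    show "(SUP K\<in>{K. compactin Y K \<and> K \<subseteq> A}. emeasure borel_ext K) \<le> emeasure borel_ext A"
      using A by (intro SUP_least emeasure_mono) auto
  qed
  then show ?thesis
    unfolding regular_borel_prob_def using out borel_ext_basic(1,2) prob_space_axioms by blast
qed

lemma m_le_borel_ext: "closedin Y C \<Longrightarrow> m C \<le> emeasure borel_ext C"
  by (simp add: borel_ext_basic(3) closed_in_borel_ext m_le_outer)

end

theorem regular_borel_prob_above_content:
  assumes "compact_space Y" "Hausdorff_space Y"
    and "\<And>A B. A \<subseteq> topspace Y \<Longrightarrow> B \<subseteq> topspace Y \<Longrightarrow> A \<inter> B = {} \<Longrightarrow> m (A \<union> B) = m A + m B"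
    and "m (topspace Y) = (1::ennreal)"
  obtains \<mu> where "regular_borel_prob Y \<mu>" "\<And>C. closedin Y C \<Longrightarrow> m C \<le> emeasure \<mu> C"
proof -
  interpret content Y m using assms by unfold_locales
  show thesis using that regular_borel_ext m_le_borel_ext by blast
qed

section \<open>Means on bounded functions and their representing measures\<close>

text \<open>
  Every function on a discrete space is continuous, so the bounded continuous functions on the
  discrete copy of a type form the Banach space of all its bounded functions. For an unbounded \<open>g\<close>
  the value of \<open>bfun g\<close> is unspecified.
\<close>

definition bfun :: "('k \<Rightarrow> real) \<Rightarrow> ('k discrete \<Rightarrow>\<^sub>C real)" where
  "bfun g = Bcontfun (\<lambda>d. g (of_discrete d))"

lemma apply_bfun:
  assumes "bounded (range g)"
  shows "apply_bcontfun (bfun g) d = g (of_discrete d)"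
proof -
  have "continuous_on UNIV (\<lambda>d. g (of_discrete d))"
    by (simp add: continuous_on_open_vimage[OF open_UNIV] open_discrete)
  moreover have "range (\<lambda>d. g (of_discrete d)) \<subseteq> range g" by auto
  ultimately have "(\<lambda>d. g (of_discrete d)) \<in> bcontfun"
    using assms bounded_subset by (auto simp: bcontfun_def)
  then show ?thesis by (simp add: bfun_def Bcontfun_inverse)
qed

text \<open>
  Means are functionals on all functions, although their behaviour is prescribed only for those
  bounded on \<open>K\<close>. This avoids a type of bounded functions on \<open>K\<close>, and integrands that are unbounded
  away from \<open>K\<close> can be used as they stand. Positivity is tested on \<open>K\<close> alone, so the mean of a
  function depends only on its values on \<open>K\<close>.
\<close>

definition mean_on :: "'k set \<Rightarrow> (('k \<Rightarrow> real) \<Rightarrow> real) \<Rightarrow> bool" where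
  "mean_on K M \<longleftrightarrow>
     (\<forall>f g. bounded (f ` K) \<longrightarrow> bounded (g ` K) \<longrightarrow> M (\<lambda>k. f k + g k) = M f + M g) \<and>
     (\<forall>c f. bounded (f ` K) \<longrightarrow> M (\<lambda>k. c * f k) = c * M f) \<and>
     (\<forall>f. bounded (f ` K) \<longrightarrow> (\<forall>k\<in>K. 0 \<le> f k) \<longrightarrow> 0 \<le> M f) \<and>
     M (\<lambda>_. 1) = 1"

lemma mean_onD:
  assumes "mean_on K M"
  shows "bounded (f ` K) \<Longrightarrow> bounded (g ` K) \<Longrightarrow> M (\<lambda>k. f k + g k) = M f + M g"
    and "bounded (f ` K) \<Longrightarrow> M (\<lambda>k. c * f k) = c * M f"
    and "bounded (f ` K) \<Longrightarrow> (\<And>k. k \<in> K \<Longrightarrow> 0 \<le> f k) \<Longrightarrow> 0 \<le> M f"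
    and "M (\<lambda>_. c) = c"
proof -
  show "bounded (f ` K) \<Longrightarrow> bounded (g ` K) \<Longrightarrow> M (\<lambda>k. f k + g k) = M f + M g"
    and scale: "\<And>f c. bounded (f ` K) \<Longrightarrow> M (\<lambda>k. c * f k) = c * M f"
    and "bounded (f ` K) \<Longrightarrow> (\<And>k. k \<in> K \<Longrightarrow> 0 \<le> f k) \<Longrightarrow> 0 \<le> M f"
    using assms unfolding mean_on_def by blast+
  show "M (\<lambda>_. c) = c"
    using scale[of "\<lambda>_. 1" c] assms by (simp add: mean_on_def image_constant_conv)
qed

lemma mean_on_mono:
  assumes M: "mean_on K M" and b: "bounded (f ` K)" "bounded (g ` K)"
    and le: "\<And>k. k \<in> K \<Longrightarrow> f k \<le> g k"
  shows "M f \<le> M g"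
proof -
  have "bounded ((\<lambda>k. - 1 * f k) ` K)"
    using bounded_scaleR_comp[OF b(1), of "- 1"] by simp
  then have "M (\<lambda>k. g k + - 1 * f k) = M g + - 1 * M f"
    using mean_onD(1)[OF M b(2), of "\<lambda>k. - 1 * f k"] mean_onD(2)[OF M b(1), of "- 1"] by simp
  moreover have "0 \<le> M (\<lambda>k. g k + - 1 * f k)"
    using le bounded_minus_comp[OF b(2,1)] by (intro mean_onD(3)[OF M]) auto
  ultimately show ?thesis by simp
qed

lemma mean_on_cong:
  assumes "mean_on K M" "bounded (g ` K)" "\<And>k. k \<in> K \<Longrightarrow> f k = g k"
  shows "M f = M g"
proof -
  have "bounded (f ` K)" using assms(2,3) by (simp cong: image_cong)
  then show ?thesis using assms by (intro antisym mean_on_mono[OF assms(1)]) auto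
qed

lemma bounded_sum_image:
  fixes f :: "'i \<Rightarrow> 'k \<Rightarrow> real"
  assumes "\<And>i. i \<in> I \<Longrightarrow> bounded (f i ` K)"
  shows "bounded ((\<lambda>k. \<Sum>i\<in>I. f i k) ` K)"
  using assms by (induction I rule: infinite_finite_induct) (auto simp: image_constant_conv intro!: bounded_plus_comp)

lemma mean_on_sum:
  assumes M: "mean_on K M" and "finite I" "\<And>i. i \<in> I \<Longrightarrow> bounded (f i ` K)"
  shows "M (\<lambda>k. \<Sum>i\<in>I. f i k) = (\<Sum>i\<in>I. M (f i))"
  using assms(2,3)
  by (induction I rule: finite_induct) (auto simp: mean_onD(4)[OF M] mean_onD(1)[OF M] bounded_sum_image)

lemma mean_on_image:
  assumes M: "mean_on K M" and "\<pi> ` K \<subseteq> K'"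
  shows "mean_on K' (\<lambda>f. M (\<lambda>k. f (\<pi> k)))"
proof -
  have b: "bounded ((\<lambda>k. f (\<pi> k)) ` K)" if "bounded (f ` K')" for f :: "'b \<Rightarrow> real"
    using bounded_subset[OF that, of "(\<lambda>k. f (\<pi> k)) ` K"] assms(2) by auto
  show ?thesis
    using assms(2) unfolding mean_on_def
    by (auto simp: mean_onD(1,2,4)[OF M] b intro!: mean_onD(3)[OF M])
qed

text \<open>
  The last hypothesis says that the sublinear functional \<open>sup\<close> over \<open>K\<close> is nonnegative on the
  convex cone generated by \<open>\<A>\<close>. So the theorem of Mazur and Orlicz gives a linear functional below \<open>sup\<close> that is
  nonnegative on the cone. Being below \<open>sup\<close> makes it positive and normalized.
\<close>

lemma mean_separating_cone:
  fixes K :: "'k set" and \<A> :: "('k \<Rightarrow> real) set"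
  assumes K: "K \<noteq> {}"
    and bdd: "\<And>a. a \<in> \<A> \<Longrightarrow> bounded (a ` K)"
    and scale: "\<And>a t. a \<in> \<A> \<Longrightarrow> t > 0 \<Longrightarrow> (\<lambda>k. t * a k) \<in> \<A>"
    and nonneg: "\<And>(n::nat) a \<epsilon>. (\<And>j. j < n \<Longrightarrow> a j \<in> \<A>) \<Longrightarrow> \<epsilon> > 0 \<Longrightarrow> \<exists>k\<in>K. - \<epsilon> < (\<Sum>j<n. a j k)"
  obtains M where "mean_on K M" "\<And>a. a \<in> \<A> \<Longrightarrow> 0 \<le> M a"
proof -
  \<comment> \<open>Extension by zero makes a function that is bounded on \<open>K\<close> bounded everywhere.\<close>
  define E where "E g = bfun (\<lambda>k. if k \<in> K then g k else 0)" for g :: "'k \<Rightarrow> real"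
  have E: "apply_bcontfun (E g) d = (if of_discrete d \<in> K then g (of_discrete d) else 0)"
    if "bounded (g ` K)" for g d
  proof -
    have "range (\<lambda>k. if k \<in> K then g k else 0) \<subseteq> insert 0 (g ` K)" by auto
    then have "bounded (range (\<lambda>k. if k \<in> K then g k else 0))" using that bounded_subset bounded_insert by metis
    from apply_bfun[OF this] show ?thesis by (simp add: E_def)
  qed
  have E_add: "E (\<lambda>k. f k + g k) = E f + E g" if "bounded (f ` K)" "bounded (g ` K)" for f g
    using that by (intro bcontfun_eqI) (simp add: E bounded_plus_comp)
  have E_scale: "E (\<lambda>k. c * g k) = c *\<^sub>R E g" if "bounded (g ` K)" for c g
  proof -
    have "bounded ((\<lambda>k. c * g k) ` K)" using bounded_scaleR_comp[OF that, of c] by simp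
    then show ?thesis using that by (intro bcontfun_eqI) (simp add: E)
  qed
  define P where "P \<phi> = (SUP k\<in>K. apply_bcontfun \<phi> (discrete k))" for \<phi> :: "'k discrete \<Rightarrow>\<^sub>C real"
  have P_bdd: "bdd_above ((\<lambda>k. apply_bcontfun \<phi> (discrete k)) ` K)" for \<phi> :: "'k discrete \<Rightarrow>\<^sub>C real"
  proof -
    have "apply_bcontfun \<phi> d \<le> norm \<phi>" for d using norm_bounded[of \<phi> d] by simp
    then show ?thesis by (auto simp: bdd_above_def)
  qed
  have P_ge: "apply_bcontfun \<phi> (discrete k) \<le> P \<phi>" if "k \<in> K" for \<phi> k
    unfolding P_def by (intro cSUP_upper P_bdd that)
  have P_le: "P \<phi> \<le> z" if "\<And>k. k \<in> K \<Longrightarrow> apply_bcontfun \<phi> (discrete k) \<le> z" for \<phi> z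
    unfolding P_def using K that by (intro cSUP_least) auto
  have "sublinear P" unfolding sublinear_def
    using P_ge by (auto intro!: P_le add_mono)
  let ?\<Psi> = "{(E (\<lambda>k. \<Sum>j<n. a j k), 0 :: real) | (n::nat) a. \<forall>j<n. a j \<in> \<A>}"
  have sum_bdd: "bounded ((\<lambda>k. \<Sum>j<n. a j k) ` K)" if "\<forall>j<n. a j \<in> \<A>" for n :: nat and a
    using that bdd by (intro bounded_sum_image) auto
  have "\<exists>L. linear L \<and> (\<forall>\<phi>. L \<phi> \<le> P \<phi>) \<and> (\<forall>\<psi> c. (\<psi>, c) \<in> ?\<Psi> \<longrightarrow> c \<le> L \<psi>)"
  proof (rule mazur_orlicz[OF \<open>sublinear P\<close>, of ?\<Psi>])
    have "E (\<lambda>k. \<Sum>j<(0::nat). undefined j k) = 0"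
      by (intro bcontfun_eqI) (simp add: E image_constant_conv)
    then show "0 \<in> ?\<Psi>" by (auto simp: zero_prod_def intro!: exI[of _ "0::nat"])
  next
    fix u v assume "u \<in> ?\<Psi>" "v \<in> ?\<Psi>"
    then obtain m n :: nat and a b where u: "u = (E (\<lambda>k. \<Sum>j<m. a j k), 0)" "\<forall>j<m. a j \<in> \<A>"
      and v: "v = (E (\<lambda>k. \<Sum>j<n. b j k), 0)" "\<forall>j<n. b j \<in> \<A>" by auto
    define c where "c j = (if j < m then a j else b (j - m))" for j
    have "(\<Sum>j<m + n. c j k) = (\<Sum>j<m. a j k) + (\<Sum>j<n. b j k)" for k
    proof -
      have "(\<Sum>j<m + n. c j k) = (\<Sum>j<m. c j k) + (\<Sum>j\<in>{m..<m + n}. c j k)"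
        by (subst sum.union_disjoint[symmetric]) (auto intro: sum.cong)
      also have "(\<Sum>j\<in>{m..<m + n}. c j k) = (\<Sum>j<n. c (j + m) k)"
        using sum.shift_bounds_nat_ivl[of "\<lambda>j. c j k" 0 m n] by (simp add: add.commute atLeast0LessThan)
      finally show ?thesis by (simp add: c_def)
    qed
    then have "u + v = (E (\<lambda>k. \<Sum>j<m + n. c j k), 0)"
      using u v E_add sum_bdd by simp
    moreover have "\<forall>j<m + n. c j \<in> \<A>" using u(2) v(2) by (auto simp: c_def)
    ultimately show "u + v \<in> ?\<Psi>" by blast
  next
    fix t :: real and u assume "t > 0" "u \<in> ?\<Psi>"
    then obtain m :: nat and a where u: "u = (E (\<lambda>k. \<Sum>j<m. a j k), 0)" "\<forall>j<m. a j \<in> \<A>" by auto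
    have "t *\<^sub>R u = (E (\<lambda>k. \<Sum>j<m. t * a j k), 0)"
      using u E_scale[OF sum_bdd[OF u(2)], of t] by (simp add: sum_distrib_left)
    moreover have "\<forall>j<m. (\<lambda>j k. t * a j k) j \<in> \<A>" using u(2) scale \<open>t > 0\<close> by blast
    ultimately show "t *\<^sub>R u \<in> ?\<Psi>" by (intro CollectI exI[of _ m] exI[of _ "\<lambda>j k. t * a j k"] conjI)
  next
    fix \<psi> and c :: real assume "(\<psi>, c) \<in> ?\<Psi>"
    then obtain m :: nat and a where a: "\<psi> = E (\<lambda>k. \<Sum>j<m. a j k)" "c = 0" "\<forall>j<m. a j \<in> \<A>" by auto
    show "c \<le> P \<psi>"
    proof (rule field_le_epsilon)
      fix \<epsilon> :: real assume "\<epsilon> > 0"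
      then obtain k where "k \<in> K" "- \<epsilon> < (\<Sum>j<m. a j k)" using nonneg a(3) by blast
      then show "c \<le> P \<psi> + \<epsilon>"
        using P_ge[of k \<psi>] a E[OF sum_bdd[OF a(3)], of "discrete k"] by (simp add: discrete_inverse)
    qed
  qed blast
  then obtain L where L: "linear L" "\<And>\<phi>. L \<phi> \<le> P \<phi>" and cone: "\<And>\<psi> c. (\<psi>, c) \<in> ?\<Psi> \<Longrightarrow> c \<le> L \<psi>"
    by blast
  have L_ge: "z \<le> L (E f)" if "bounded (f ` K)" "\<And>k. k \<in> K \<Longrightarrow> z \<le> f k" for z f
  proof -
    have "L (- E f) \<le> - z"
      using that by (intro order_trans[OF L(2)] P_le) (simp add: E discrete_inverse)
    then show ?thesis using linear_neg[OF L(1)] by simp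
  qed
  have "L (E (\<lambda>_. 1)) \<le> 1"
    by (intro order_trans[OF L(2)] P_le) (simp add: E discrete_inverse image_constant_conv)
  then have "L (E (\<lambda>_. 1)) = 1" using L_ge[of "\<lambda>_. 1" 1] by (simp add: image_constant_conv)
  then have "mean_on K (\<lambda>f. L (E f))"
    unfolding mean_on_def using L(1) L_ge by (auto simp: E_add E_scale linear_add linear_scale)
  moreover have "0 \<le> L (E a)" if "a \<in> \<A>" for a
    using that by (intro cone) (auto intro!: exI[of _ "Suc 0"] exI[of _ "\<lambda>_. a"])
  ultimately show thesis using that by blast
qed

text \<open>
  The sum is \<open>y\<close> rounded down to a multiple of \<open>B / n\<close>, written as a sum over the levels that
  \<open>y\<close> reaches. Applied to the values of a function it approximates the function uniformly by
  indicators of superlevel sets.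
\<close>

lemma layer_sum_bounds:
  fixes y B :: real and n :: nat
  assumes "0 \<le> y" "y \<le> B" "0 < B" "0 < n"
  defines "s \<equiv> (\<Sum>i\<in>{1..n}. B / n * (if real i * B / n \<le> y then 1 else 0))"
  shows "s \<le> y" "y \<le> B / n + s"
proof -
  define l where "l = nat \<lfloor>y * n / B\<rfloor>"
  have l: "real l \<le> y * n / B" "y * n / B < real l + 1"
    using assms(1-4) by (simp_all add: l_def of_nat_floor)
  have "y * n / B \<le> n" using assms by (simp add: field_simps)
  then have "l \<le> n" using l by linarith
  have "(real i * B / n \<le> y) = (i \<le> l)" for i
  proof -
    have "(real i * B / n \<le> y) = (real i \<le> y * n / B)" using assms by (simp add: field_simps)
    also have "\<dots> = (i \<le> l)" using l by linarith
    finally show ?thesis .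
  qed
  then have "s = (\<Sum>i\<in>{1..n}. if i \<le> l then B / n else 0)" unfolding s_def by (intro sum.cong) auto
  also have "\<dots> = (\<Sum>i\<in>{1..l}. B / n)" using \<open>l \<le> n\<close>
    by (intro sum.mono_neutral_cong_right) auto
  finally have s: "s = real l * B / n" by simp
  show "s \<le> y" "y \<le> B / n + s" using l assms(3,4) unfolding s by (auto simp: field_simps)
qed

lemma closedin_superlevel:
  assumes "continuous_map Y euclideanreal g"
  shows "closedin Y {k \<in> topspace Y. t \<le> g k}"
  using closedin_continuous_map_preimage[OF assms, of "{t..}"] by simp

lemma regular_borel_prob_measurable:
  assumes "regular_borel_prob Y \<mu>" "continuous_map Y euclideanreal g"
  shows "g \<in> borel_measurable \<mu>"
proof (rule borel_measurableI)
  fix S :: "real set" assume "open S"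
  then have "openin Y {k \<in> topspace Y. g k \<in> S}"
    using openin_continuous_map_preimage[OF assms(2), of S] by simp
  moreover have "g -` S \<inter> space \<mu> = {k \<in> topspace Y. g k \<in> S}"
    using assms(1) by (auto simp: regular_borel_prob_def)
  ultimately show "g -` S \<inter> space \<mu> \<in> sets \<mu>"
    using assms(1) by (auto simp: regular_borel_prob_def)
qed

lemma continuous_map_bounded_image:
  assumes "compact_space Y" "continuous_map Y euclideanreal g"
  shows "bounded (g ` topspace Y)"
  using image_compactin[OF _ assms(2), of "topspace Y"] assms(1)
  by (simp add: compact_space_def compact_imp_bounded)

lemma regular_borel_prob_integrable:
  assumes "regular_borel_prob Y \<mu>" "continuous_map Y euclideanreal g" "bounded (g ` topspace Y)"
  shows "integrable \<mu> g"
proof -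
  interpret prob_space \<mu> using assms(1) by (simp add: regular_borel_prob_def)
  obtain B where "\<forall>y\<in>g ` topspace Y. norm y \<le> B" using assms(3) bounded_iff by blast
  then show ?thesis
    using assms(1) regular_borel_prob_measurable[OF assms(1,2)]
    by (intro integrable_const_bound[of _ B] AE_I2) (auto simp: regular_borel_prob_def)
qed

text \<open>
  A weak form of the Riesz representation theorem: an inequality in place of an equality, which
  suffices because means are only to be replaced by integrals in upper bounds. The measure is the
  one constructed from \<open>m A = M\<close> of the indicator of \<open>A\<close>. The superlevel sets of a continuous \<open>g\<close> are
  closed, so the measure dominates \<open>m\<close> on them, and \<open>g\<close> is a uniform limit of nonnegative combinations of
  their indicators.
\<close>

theorem mean_below_regular_borel_prob:
  assumes Y: "compact_space Y" "Hausdorff_space Y" and M: "mean_on (topspace Y) M"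
  shows "\<exists>\<mu>. regular_borel_prob Y \<mu> \<and>
    (\<forall>g. continuous_map Y euclideanreal g \<longrightarrow> (\<forall>k\<in>topspace Y. 0 \<le> g k) \<longrightarrow> M g \<le> (\<integral>k. g k \<partial>\<mu>))"
proof -
  let ?K = "topspace Y"
  define ind where "ind A k = (if k \<in> A then 1 else 0 :: real)" for A and k :: 'a
  have ind_bdd: "bounded (ind A ` S)" for A S
    by (rule bounded_subset[of "{0, 1}"]) (auto simp: ind_def)
  have ind_nonneg: "0 \<le> M (ind A)" for A
    by (intro mean_onD(3)[OF M] ind_bdd) (simp add: ind_def)
  define m where "m A = ennreal (M (ind A))" for A
  have "m (A \<union> B) = m A + m B" if "A \<inter> B = {}" for A B
  proof -
    have "M (ind (A \<union> B)) = M (\<lambda>k. ind A k + ind B k)"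
      using that by (intro arg_cong[of _ _ M] ext) (auto simp: ind_def)
    also have "\<dots> = M (ind A) + M (ind B)" by (intro mean_onD(1)[OF M] ind_bdd)
    finally show ?thesis using ind_nonneg by (simp add: m_def)
  qed
  moreover have "m ?K = 1"
  proof -
    have "M (ind ?K) = M (\<lambda>_. 1)" by (intro mean_on_cong[OF M]) (auto simp: ind_def image_constant_conv)
    then show ?thesis by (simp add: m_def mean_onD(4)[OF M])
  qed
  ultimately obtain \<mu> where \<mu>: "regular_borel_prob Y \<mu>" and m_le: "\<And>C. closedin Y C \<Longrightarrow> m C \<le> emeasure \<mu> C"
    using regular_borel_prob_above_content[OF Y, of m] by metis
  interpret prob_space \<mu> using \<mu> by (simp add: regular_borel_prob_def)
  have sp: "space \<mu> = ?K" using \<mu> by (simp add: regular_borel_prob_def)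
  have "M g \<le> (\<integral>k. g k \<partial>\<mu>)" if g: "continuous_map Y euclideanreal g" "\<And>k. k \<in> ?K \<Longrightarrow> 0 \<le> g k" for g
  proof -
    have g_bdd: "bounded (g ` ?K)" by (rule continuous_map_bounded_image[OF Y(1) g(1)])
    then obtain B where B: "0 < B" "\<And>k. k \<in> ?K \<Longrightarrow> g k \<le> B"
      using bounded_pos[of "g ` ?K"] by (auto simp: abs_le_iff)
    have g_int: "integrable \<mu> g" by (rule regular_borel_prob_integrable[OF \<mu> g(1) g_bdd])
    have approx: "M g \<le> B / n + (\<integral>k. g k \<partial>\<mu>)" if n: "0 < n" for n :: nat
    proof -
      define C where "C i = {k \<in> ?K. real i * B / n \<le> g k}" for i
      define s where "s k = (\<Sum>i\<in>{1..n}. B / n * ind (C i) k)" for k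
      have C: "closedin Y (C i)" for i unfolding C_def by (rule closedin_superlevel[OF g(1)])
      have C_sets: "C i \<in> sets \<mu>" for i
      proof -
        have "{k \<in> space \<mu>. real i * B / n \<le> g k} \<in> sets \<mu>"
          using regular_borel_prob_measurable[OF \<mu> g(1)] by measurable
        then show ?thesis by (simp add: C_def sp)
      qed
      have ind_eq: "ind (C i) = indicator (C i)" for i by (auto simp: ind_def)
      have term_int: "integrable \<mu> (\<lambda>k. B / n * ind (C i) k)" for i
        unfolding ind_eq using C_sets
        by (intro integrable_mult_right integrable_real_indicator) (auto simp: emeasure_eq_measure)
      have s: "s k \<le> g k" "g k \<le> B / n + s k" if "k \<in> ?K" for k
        using layer_sum_bounds[OF g(2)[OF that] B(2)[OF that] B(1) n] that
        by (simp_all add: s_def ind_def C_def)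
      have term_bdd: "bounded ((\<lambda>k. B / n * ind (C i) k) ` S)" for i S
        using bounded_scaleR_comp[OF ind_bdd, of "B / n" "C i" S] by simp
      have s_bdd: "bounded (s ` S)" for S unfolding s_def by (intro bounded_sum_image term_bdd)
      have "M g \<le> M (\<lambda>k. B / n + s k)"
        using s s_bdd by (intro mean_on_mono[OF M g_bdd] bounded_plus_comp) (auto simp: image_constant_conv)
      also have "\<dots> = B / n + M s"
        using s_bdd by (subst mean_onD(1)[OF M]) (auto simp: image_constant_conv mean_onD(4)[OF M])
      also have "M s = (\<Sum>i\<in>{1..n}. B / n * M (ind (C i)))"
        unfolding s_def
        by (subst mean_on_sum[OF M]) (simp_all only: term_bdd mean_onD(2)[OF M ind_bdd] finite_atLeastAtMost)
      also have "\<dots> \<le> (\<Sum>i\<in>{1..n}. B / n * measure \<mu> (C i))"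
      proof (intro sum_mono mult_left_mono)
        show "M (ind (C i)) \<le> measure \<mu> (C i)" for i
          using m_le[OF C, of i] by (simp add: m_def emeasure_eq_measure)
      qed (use B in auto)
      also have "\<dots> = (\<integral>k. s k \<partial>\<mu>)"
        unfolding s_def using C_sets
        by (subst Bochner_Integration.integral_sum[OF term_int]) (simp add: ind_eq)
      also have "\<dots> \<le> (\<integral>k. g k \<partial>\<mu>)"
      proof (rule integral_mono)
        show "integrable \<mu> s"
          unfolding s_def by (intro Bochner_Integration.integrable_sum term_int)
      qed (use g_int s sp in auto)
      finally show ?thesis by simp
    qed
    have "(\<lambda>n. B / real n + (\<integral>k. g k \<partial>\<mu>)) \<longlonglongrightarrow> 0 + (\<integral>k. g k \<partial>\<mu>)"
      by (intro tendsto_add lim_const_over_n tendsto_const)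
    moreover have "\<forall>\<^sub>F n in sequentially. M g \<le> B / real n + (\<integral>k. g k \<partial>\<mu>)"
      by (intro eventually_sequentiallyI[of 1] approx) simp
    ultimately have "M g \<le> 0 + (\<integral>k. g k \<partial>\<mu>)"
      by (rule tendsto_lowerbound) simp
    then show ?thesis by simp
  qed
  then show ?thesis using \<mu> by blast
qed

section \<open>Inequalities of Hoelder and Minkowski\<close>

lemma weighted_am_gm:
  fixes a b :: real
  assumes "0 < \<alpha>" "0 < \<beta>" "\<alpha> + \<beta> = 1" "0 \<le> a" "0 \<le> b"
  shows "a powr \<alpha> * b powr \<beta> \<le> \<alpha> * a + \<beta> * b"
  using assms Youngs_inequality_0[of \<alpha> \<beta> a b] by (cases "a = 0 \<or> b = 0") auto

text \<open>
  After normalization of both factors to have sum one, this is the weighted inequality of the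
  arithmetic and geometric means, summed up.
\<close>

lemma Holder_sum_powr:
  fixes X Y :: "'i \<Rightarrow> real" and u v r :: real
  assumes "finite I" and X: "\<And>i. i \<in> I \<Longrightarrow> 0 \<le> X i" and Y: "\<And>i. i \<in> I \<Longrightarrow> 0 \<le> Y i"
    and uv: "0 < u" "0 < v" "0 < r" and r: "1 / r = 1 / u + 1 / v"
  shows "(\<Sum>i\<in>I. (X i * Y i) powr r) powr (1 / r)
    \<le> (\<Sum>i\<in>I. X i powr u) powr (1 / u) * (\<Sum>i\<in>I. Y i powr v) powr (1 / v)"
proof -
  define A where "A = (\<Sum>i\<in>I. X i powr u)"
  define B where "B = (\<Sum>i\<in>I. Y i powr v)"
  have nonneg: "0 \<le> A" "0 \<le> B" by (auto simp: A_def B_def intro: sum_nonneg)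
  show ?thesis
  proof (cases "A = 0 \<or> B = 0")
    case True
    then have "(X i * Y i) powr r = 0" if "i \<in> I" for i
      using that \<open>finite I\<close> by (auto simp: A_def B_def sum_nonneg_eq_0_iff)
    then have "(\<Sum>i\<in>I. (X i * Y i) powr r) = 0" by (intro sum.neutral ballI)
    then show ?thesis by simp
  next
    case False
    then have pos: "0 < A" "0 < B" using nonneg by auto
    have "r / u + r / v = r * (1 / u + 1 / v)" by (simp add: distrib_left)
    then have ab: "r / u + r / v = 1" using uv by (simp flip: r)
    have "(\<Sum>i\<in>I. (X i * Y i) powr r) / (A powr (r / u) * B powr (r / v))
        = (\<Sum>i\<in>I. (X i powr u / A) powr (r / u) * (Y i powr v / B) powr (r / v))"
      unfolding sum_divide_distrib using X Y pos uv
      by (intro sum.cong refl) (simp add: powr_divide powr_powr powr_mult)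
    also have "\<dots> \<le> (\<Sum>i\<in>I. r / u * (X i powr u / A) + r / v * (Y i powr v / B))"
      using uv ab pos by (intro sum_mono weighted_am_gm) auto
    also have "\<dots> = r / u * (A / A) + r / v * (B / B)"
      unfolding sum.distrib sum_distrib_left[symmetric] sum_divide_distrib[symmetric]
        A_def[symmetric] B_def[symmetric] ..
    also have "\<dots> = 1" using pos ab by simp
    finally have "(\<Sum>i\<in>I. (X i * Y i) powr r) \<le> A powr (r / u) * B powr (r / v)"
      using pos by (simp add: field_simps)
    then have "(\<Sum>i\<in>I. (X i * Y i) powr r) powr (1 / r) \<le> (A powr (r / u) * B powr (r / v)) powr (1 / r)"
      using uv by (intro powr_mono2 sum_nonneg) auto
    also have "\<dots> = A powr (1 / u) * B powr (1 / v)"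
      using pos uv by (simp add: powr_mult powr_powr)
    finally show ?thesis by (simp add: A_def B_def)
  qed
qed

lemma powr_convex_combination:
  fixes x y :: real
  assumes "1 \<le> p" "0 \<le> x" "0 \<le> y" "0 \<le> s" "0 \<le> t" "s + t = 1"
  shows "(s * x + t * y) powr p \<le> s * x powr p + t * y powr p"
proof -
  have le: "(s * x) powr p \<le> s * x powr p" if "0 \<le> s" "s \<le> 1" "0 \<le> x" for s x :: real
  proof -
    have "s powr p \<le> s"
      using powr_mono'[of 1 p s] that assms(1) by (cases "s = 0") auto
    then show ?thesis using that by (simp add: powr_mult mult_right_mono)
  qed
  show ?thesis
  proof (cases "x = 0 \<or> y = 0")
    case True
    then show ?thesis using le[of s x] le[of t y] assms by auto
  next
    case False
    then show ?thesis
      using powr_convex[OF assms(1)] assms by (auto simp: convex_on_def)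
  qed
qed

text \<open>
  If \<open>a\<close> and \<open>b\<close> exceed the two norms on the right, then \<open>\<bar>u + v\<bar> / (a + b)\<close> is at most the convex
  combination of \<open>\<bar>u\<bar> / a\<close> and \<open>\<bar>v\<bar> / b\<close> with weights \<open>a / (a + b)\<close> and \<open>b / (a + b)\<close>, so by convexity of the power its \<open>p\<close>-th
  power has integral at most one. Adding \<open>e / 2\<close> to each norm keeps \<open>a\<close> and \<open>b\<close> positive.
\<close>

lemma Minkowski_integral:
  fixes u v :: "'c \<Rightarrow> real"
  assumes p: "1 \<le> p"
    and u: "integrable M (\<lambda>x. \<bar>u x\<bar> powr p)" and v: "integrable M (\<lambda>x. \<bar>v x\<bar> powr p)"
    and uv: "integrable M (\<lambda>x. \<bar>u x + v x\<bar> powr p)"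
  shows "(\<integral>x. \<bar>u x + v x\<bar> powr p \<partial>M) powr (1 / p)
    \<le> (\<integral>x. \<bar>u x\<bar> powr p \<partial>M) powr (1 / p) + (\<integral>x. \<bar>v x\<bar> powr p \<partial>M) powr (1 / p)"
proof (rule field_le_epsilon)
  fix e :: real assume e: "0 < e"
  define U where "U = (\<integral>x. \<bar>u x\<bar> powr p \<partial>M)"
  define V where "V = (\<integral>x. \<bar>v x\<bar> powr p \<partial>M)"
  define a where "a = U powr (1 / p) + e / 2"
  define b where "b = V powr (1 / p) + e / 2"
  have nonneg: "0 \<le> U" "0 \<le> V" by (simp_all add: U_def V_def)
  have pos: "0 < a" "0 < b" using e by (auto simp: a_def b_def add_nonneg_pos)
  have "U = (U powr (1 / p)) powr p" "V = (V powr (1 / p)) powr p"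
    using nonneg p by (simp_all add: powr_powr)
  moreover have "(U powr (1 / p)) powr p \<le> a powr p" "(V powr (1 / p)) powr p \<le> b powr p"
    using e p by (auto simp: a_def b_def intro!: powr_mono2)
  ultimately have UV: "U / a powr p \<le> 1" "V / b powr p \<le> 1" using pos by (simp_all add: divide_le_eq_1)
  have pointwise: "\<bar>u x + v x\<bar> powr p
      \<le> (a + b) powr p * (a / (a + b) * (\<bar>u x\<bar> powr p / a powr p) + b / (a + b) * (\<bar>v x\<bar> powr p / b powr p))" for x
  proof -
    have "(a + b) * (a / (a + b) * (\<bar>u x\<bar> / a) + b / (a + b) * (\<bar>v x\<bar> / b)) = \<bar>u x\<bar> + \<bar>v x\<bar>"
      using pos by (simp flip: add_divide_distrib)
    then have "\<bar>u x + v x\<bar> \<le> (a + b) * (a / (a + b) * (\<bar>u x\<bar> / a) + b / (a + b) * (\<bar>v x\<bar> / b))"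
      by (simp add: abs_triangle_ineq)
    then have "\<bar>u x + v x\<bar> powr p \<le> ((a + b) * (a / (a + b) * (\<bar>u x\<bar> / a) + b / (a + b) * (\<bar>v x\<bar> / b))) powr p"
      using p by (intro powr_mono2) auto
    also have "\<dots> = (a + b) powr p * (a / (a + b) * (\<bar>u x\<bar> / a) + b / (a + b) * (\<bar>v x\<bar> / b)) powr p"
      using pos by (intro powr_mult)
    also have "\<dots> \<le> (a + b) powr p * (a / (a + b) * (\<bar>u x\<bar> / a) powr p + b / (a + b) * (\<bar>v x\<bar> / b) powr p)"
      using pos p by (intro mult_left_mono powr_convex_combination) (auto simp flip: add_divide_distrib)
    finally show ?thesis using pos by (simp add: powr_divide)
  qed
  have "(\<integral>x. \<bar>u x + v x\<bar> powr p \<partial>M)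
      \<le> (\<integral>x. (a + b) powr p * (a / (a + b) * (\<bar>u x\<bar> powr p / a powr p) + b / (a + b) * (\<bar>v x\<bar> powr p / b powr p)) \<partial>M)"
    using u v by (intro integral_mono uv pointwise) auto
  also have "\<dots> = (a + b) powr p * (a / (a + b) * (U / a powr p) + b / (a + b) * (V / b powr p))"
    using u v by (simp add: U_def V_def)
  also have "\<dots> \<le> (a + b) powr p * (a / (a + b) * 1 + b / (a + b) * 1)"
    using pos UV by (intro mult_left_mono add_mono) auto
  also have "\<dots> = (a + b) powr p" using pos by (simp flip: add_divide_distrib)
  finally have "(\<integral>x. \<bar>u x + v x\<bar> powr p \<partial>M) powr (1 / p) \<le> ((a + b) powr p) powr (1 / p)"
    using p by (intro powr_mono2) auto
  also have "\<dots> = a + b" using pos p by (simp add: powr_powr)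
  finally show "(\<integral>x. \<bar>u x + v x\<bar> powr p \<partial>M) powr (1 / p)
      \<le> (\<integral>x. \<bar>u x\<bar> powr p \<partial>M) powr (1 / p) + (\<integral>x. \<bar>v x\<bar> powr p \<partial>M) powr (1 / p) + e"
    by (simp add: a_def b_def U_def V_def)
qed

section \<open>Compactness of the Lipschitz ball and of the dual ball\<close>

text \<open>
  Tychonoff's theorem: such a set is a closed subset of a product of compact intervals.
\<close>

lemma compact_pointwise_bounded:
  fixes S :: "('k \<Rightarrow> real) set"
  assumes "closed S" "\<And>g k. g \<in> S \<Longrightarrow> \<bar>g k\<bar> \<le> r k"
  shows "compact S"
proof -
  have "compactin (product_topology (\<lambda>_. euclideanreal) UNIV) (PiE UNIV (\<lambda>k. {- r k..r k}))"
    by (subst compactin_PiE) auto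
  then have "compact (PiE UNIV (\<lambda>k. {- r k..r k}))"
    by (simp add: euclidean_product_topology)
  moreover have "S = S \<inter> PiE UNIV (\<lambda>k. {- r k..r k})"
    using assms(2) by (fastforce simp: abs_le_iff PiE_UNIV_domain minus_le_iff)
  ultimately show ?thesis using assms(1) by (metis closed_Int_compact)
qed

text \<open>
  The Lipschitz constant, defined as an infimum, is itself a Lipschitz constant.
\<close>

lemma lip_ball_iff: "f \<in> lip_ball x0 \<longleftrightarrow> f x0 = 0 \<and> (\<forall>x y. \<bar>f x - f y\<bar> \<le> dist x y)"
proof -
  have "1-lipschitz_on UNIV f" if L: "L-lipschitz_on UNIV f" and c: "lip_const f \<le> 1" for L
  proof (rule lipschitz_onI)
    fix x y
    show "dist (f x) (f y) \<le> 1 * dist x y"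
    proof (rule field_le_epsilon)
      fix e :: real assume e: "0 < e"
      define d where "d = e / (dist x y + 1)"
      have "0 < dist x y + 1" by (simp add: add_nonneg_pos)
      then have d: "0 < d" "d * dist x y \<le> e" using e by (auto simp: d_def field_simps)
      have "Inf {L. L-lipschitz_on UNIV f} < 1 + d" using c d by (simp add: lip_const_def)
      then obtain L' where "L'-lipschitz_on UNIV f" "L' < 1 + d"
        using L by (subst (asm) cInf_less_iff) (auto simp: bdd_below_def lipschitz_on_def)
      then have "dist (f x) (f y) \<le> (1 + d) * dist x y"
        by (auto simp: lipschitz_on_def intro: order_trans[OF _ mult_right_mono[of L' "1 + d"]])
      then show "dist (f x) (f y) \<le> 1 * dist x y + e" using d by (simp add: algebra_simps)
    qed
  qed (rule zero_le_one)
  moreover have "lip_const f \<le> 1" if "1-lipschitz_on UNIV f"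
    unfolding lip_const_def using that by (intro cInf_lower) (auto simp: bdd_below_def lipschitz_on_def)
  ultimately have "f \<in> lip_ball x0 \<longleftrightarrow> f x0 = 0 \<and> 1-lipschitz_on UNIV f"
    unfolding lip_ball_def lip0_def by blast
  then show ?thesis by (auto simp: lipschitz_on_def dist_real_def)
qed

lemma zero_in_lip_ball: "(\<lambda>_. 0) \<in> lip_ball x0"
  by (simp add: lip_ball_iff)

lemma compact_lip_ball: "compact (lip_ball x0)"
proof (rule compact_pointwise_bounded)
  have "lip_ball x0 = {f. f x0 = 0 \<and> (\<forall>x y. \<bar>f x - f y\<bar> \<le> dist x y)}"
    using lip_ball_iff by blast
  then show "closed (lip_ball x0)"
    by (simp only:) (intro closed_Collect_conj closed_Collect_all closed_Collect_le closed_Collect_eq continuous_intros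
        continuous_on_product_coordinates)
  show "\<bar>f x\<bar> \<le> dist x x0" if "f \<in> lip_ball x0" for f x
    using that unfolding lip_ball_iff by (metis diff_zero)
qed

lemma topspace_lip_ball_topology [simp]: "topspace (lip_ball_topology x0) = lip_ball x0"
  by (simp add: lip_ball_topology_def)

lemma compact_space_lip_ball: "compact_space (lip_ball_topology x0)"
  using compact_lip_ball[of x0]
  by (auto simp: lip_ball_topology_def euclidean_product_topology intro!: compact_space_subtopology)

lemma Hausdorff_space_lip_ball: "Hausdorff_space (lip_ball_topology x0)"
  unfolding lip_ball_topology_def
  by (intro Hausdorff_space_subtopology) (simp add: Hausdorff_space_product_topology)

lemma continuous_map_lip_ball_eval: "continuous_map (lip_ball_topology x0) euclideanreal (\<lambda>f. f x)"
  unfolding lip_ball_topology_def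
  by (intro continuous_map_from_subtopology continuous_map_product_projection) simp

lemma topspace_dual_ball_topology [simp]: "topspace dual_ball_topology = cball 0 1"
  by (simp add: dual_ball_topology_def strong_operator_topology_topspace)

lemma continuous_map_dual_ball_eval: "continuous_map dual_ball_topology euclideanreal (\<lambda>\<xi>. blinfun_apply \<xi> x)"
  unfolding dual_ball_topology_def
  by (intro continuous_map_from_subtopology strong_operator_topology_continuous_evaluation)

lemma in_dual_ball_abs_le: "\<xi> \<in> cball (0 :: 'e::real_normed_vector dual) 1 \<Longrightarrow> \<bar>blinfun_apply \<xi> x\<bar> \<le> norm x"
  using norm_blinfun[of \<xi> x] mult_right_mono[of "norm \<xi>" 1 "norm x"] by simp

text \<open>
  The theorem of Banach and Alaoglu. The set \<open>Z\<close> of linear functions bounded by the norm is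
  pointwise closed, hence compact, and bundling such a function into a bounded operator is continuous
  into the topology of pointwise convergence.
\<close>

lemma compact_space_dual_ball: "compact_space (dual_ball_topology :: 'e::real_normed_vector dual topology)"
proof -
  define Z where "Z = {g :: 'e \<Rightarrow> real. (\<forall>x y. g (x + y) = g x + g y) \<and> (\<forall>c x. g (c *\<^sub>R x) = c * g x) \<and> (\<forall>x. \<bar>g x\<bar> \<le> norm x)}"
  have "compact Z"
  proof (rule compact_pointwise_bounded)
    show "closed Z" unfolding Z_def
      by (intro closed_Collect_conj closed_Collect_all closed_Collect_le closed_Collect_eq continuous_intros
          continuous_on_product_coordinates)
    show "\<bar>g x\<bar> \<le> norm x" if "g \<in> Z" for g x using that by (simp add: Z_def)
  qed
  have bl: "bounded_linear g" if "g \<in> Z" for g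
    using that by (intro bounded_linear_intro[of _ 1]) (auto simp: Z_def)
  have app: "blinfun_apply (Blinfun g) x = g x" if "g \<in> Z" for g x
    using bl[OF that] by (simp add: bounded_linear_Blinfun_apply)
  have "continuous_map (top_of_set Z) strong_operator_topology Blinfun"
    unfolding continuous_on_strong_operator_topo_iff_coordinatewise
  proof
    fix x
    have "continuous_map (top_of_set Z) euclidean (\<lambda>g. g x)"
      using continuous_on_product_coordinates[of x] continuous_on_subset by (simp, blast)
    then show "continuous_map (top_of_set Z) euclidean (\<lambda>g. blinfun_apply (Blinfun g) x)"
      by (rule continuous_map_eq) (simp add: app)
  qed
  then have "compactin strong_operator_topology (Blinfun ` Z)"
    using \<open>compact Z\<close> by (intro image_compactin[of "top_of_set Z"]) (auto simp: compactin_subtopology)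
  moreover have "Blinfun ` Z = cball 0 1"
  proof (intro equalityI subsetI)
    fix \<xi> :: "'e dual" assume "\<xi> \<in> cball 0 1"
    then have "blinfun_apply \<xi> \<in> Z"
      using in_dual_ball_abs_le[of \<xi>] by (auto simp: Z_def blinfun.add_right blinfun.scaleR_right)
    then show "\<xi> \<in> Blinfun ` Z" by (metis blinfun_apply_inverse imageI)
  next
    fix \<xi> :: "'e dual" assume "\<xi> \<in> Blinfun ` Z"
    then obtain g where "g \<in> Z" "\<xi> = Blinfun g" by blast
    then have "norm \<xi> \<le> 1" by (intro norm_blinfun_bound) (auto simp: app, simp add: Z_def)
    then show "\<xi> \<in> cball 0 1" by simp
  qed
  ultimately show ?thesis by (simp add: dual_ball_topology_def compact_space_subtopology)
qed

lemma Hausdorff_space_dual_ball: "Hausdorff_space (dual_ball_topology :: 'e::real_normed_vector dual topology)"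
proof -
  have "\<exists>U V. openin strong_operator_topology U \<and> openin strong_operator_topology V \<and> \<xi> \<in> U \<and> \<eta> \<in> V \<and> disjnt U V"
    if "\<xi> \<noteq> \<eta>" for \<xi> \<eta> :: "'e dual"
  proof -
    have "\<exists>x. blinfun_apply \<xi> x \<noteq> blinfun_apply \<eta> x" using that blinfun_eqI by blast
    then obtain x where "blinfun_apply \<xi> x \<noteq> blinfun_apply \<eta> x" ..
    then obtain U V where UV: "open U" "open V" "blinfun_apply \<xi> x \<in> U" "blinfun_apply \<eta> x \<in> V" "U \<inter> V = {}"
      using hausdorff by metis
    have "openin strong_operator_topology {f. blinfun_apply f x \<in> W}" if "open W" for W :: "real set"
      using openin_continuous_map_preimage[OF strong_operator_topology_continuous_evaluation, of W x] that
      by (simp add: strong_operator_topology_topspace)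
    then show ?thesis using UV
      by (intro exI[of _ "{f. blinfun_apply f x \<in> U}"] exI[of _ "{f. blinfun_apply f x \<in> V}"])
        (auto simp: disjnt_iff)
  qed
  then have "Hausdorff_space (strong_operator_topology :: 'e dual topology)"
    unfolding Hausdorff_space_def by blast
  then show ?thesis unfolding dual_ball_topology_def by (rule Hausdorff_space_subtopology)
qed

section \<open>Domination by a product of two means\<close>

text \<open>
  A two-variable form of Pietsch's domination argument. The hypothesis on finite families bounds
  a sum by the product \<open>A powr \<alpha> * B powr \<beta>\<close> of powers of two suprema, which is not convex in the data; but the
  arithmetic-geometric inequality bounds this product by \<open>\<alpha> * A + \<beta> * B\<close>, the supremum over \<open>K \<times> L\<close> of a sum of
  functions of one variable each. So the functions \<open>a i \<kappa> \<mu>\<close> below generate a cone on which the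
  supremum is nonnegative, and a mean exists that is nonnegative on all of them. Its two marginals are
  \<open>M\<close> and \<open>N\<close>. Nothing is lost by passing to the sum, since the weights \<open>\<kappa>\<close> and \<open>\<mu>\<close> are free: taking them
  inverse to the means of \<open>g i\<close> and \<open>h i\<close> puts the inequality of the means in its equality case and
  recovers the product.
\<close>

theorem bilinear_domination_by_means:
  fixes t :: "'i \<Rightarrow> real" and g :: "'i \<Rightarrow> 'k \<Rightarrow> real" and h :: "'i \<Rightarrow> 'l \<Rightarrow> real"
  assumes ne: "K \<noteq> {}" "L \<noteq> {}" and ab: "0 < \<alpha>" "0 < \<beta>" "\<alpha> + \<beta> = 1" and D: "0 \<le> D"
    and g: "\<And>i. bounded (g i ` K)" "\<And>i k. k \<in> K \<Longrightarrow> 0 \<le> g i k"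
    and h: "\<And>i. bounded (h i ` L)" "\<And>i l. l \<in> L \<Longrightarrow> 0 \<le> h i l"
    and dom: "\<And>(n::nat) i \<kappa> \<mu> A B. \<lbrakk>\<And>j. j < n \<Longrightarrow> 0 < \<kappa> j; \<And>j. j < n \<Longrightarrow> 0 < \<mu> j;
        \<And>k. k \<in> K \<Longrightarrow> (\<Sum>j<n. \<kappa> j * g (i j) k) \<le> A;
        \<And>l. l \<in> L \<Longrightarrow> (\<Sum>j<n. \<mu> j * h (i j) l) \<le> B\<rbrakk>
      \<Longrightarrow> (\<Sum>j<n. \<kappa> j powr \<alpha> * \<mu> j powr \<beta> * t (i j)) \<le> D * A powr \<alpha> * B powr \<beta>"
  obtains M N where "mean_on K M" "mean_on L N"
    "\<And>i. t i \<le> D * M (g i) powr \<alpha> * N (h i) powr \<beta>"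
proof -
  define a where "a i \<kappa> \<mu> kl = D * (\<alpha> * (\<kappa> * g i (fst kl)) + \<beta> * (\<mu> * h i (snd kl))) - \<kappa> powr \<alpha> * \<mu> powr \<beta> * t i"
    for i \<kappa> \<mu> and kl :: "'k \<times> 'l"
  let ?\<A> = "{a i \<kappa> \<mu> | i \<kappa> \<mu>. 0 < \<kappa> \<and> 0 < \<mu>}"
  have g_bdd: "bounded ((\<lambda>kl. g i (fst kl)) ` (K \<times> L))" for i
    by (rule bounded_subset[OF g(1)[of i]]) auto
  have h_bdd: "bounded ((\<lambda>kl. h i (snd kl)) ` (K \<times> L))" for i
    by (rule bounded_subset[OF h(1)[of i]]) auto
  have scale_bdd: "bounded ((\<lambda>x. c * f x) ` S)" if "bounded (f ` S)" for c and f :: "'k \<times> 'l \<Rightarrow> real" and S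
    using bounded_scaleR_comp[OF that, of c] by simp
  have comb_bdd: "bounded ((\<lambda>kl. D * (\<alpha> * (\<kappa> * g i (fst kl)) + \<beta> * (\<mu> * h i (snd kl)))) ` (K \<times> L))" for i \<kappa> \<mu>
    by (intro scale_bdd bounded_plus_comp g_bdd h_bdd)
  have const_bdd: "bounded ((\<lambda>_. c :: real) ` S)" for c S by (simp add: image_constant_conv)
  have "\<exists>M. mean_on (K \<times> L) M \<and> (\<forall>f\<in>?\<A>. 0 \<le> M f)"
  proof (rule mean_separating_cone[of "K \<times> L" ?\<A>])
    show "K \<times> L \<noteq> {}" using ne by auto
  next
    fix f assume "f \<in> ?\<A>"
    then obtain i \<kappa> \<mu> where "f = a i \<kappa> \<mu>" by blast
    then show "bounded (f ` (K \<times> L))"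
      unfolding a_def using bounded_minus_comp[OF comb_bdd const_bdd] by simp
  next
    fix f and s :: real assume "f \<in> ?\<A>" and s: "0 < s"
    then obtain i \<kappa> \<mu> where f: "f = a i \<kappa> \<mu>" "0 < \<kappa>" "0 < \<mu>" by blast
    have "s powr \<alpha> * s powr \<beta> = s" using s ab(3) by (simp flip: powr_add)
    then have "(s * \<kappa>) powr \<alpha> * (s * \<mu>) powr \<beta> = s * (\<kappa> powr \<alpha> * \<mu> powr \<beta>)"
      using s f by (simp add: powr_mult mult_ac)
    then have "(\<lambda>kl. s * f kl) = a i (s * \<kappa>) (s * \<mu>)"
      by (auto simp: f(1) a_def algebra_simps)
    moreover have "0 < s * \<kappa>" "0 < s * \<mu>" using s f by simp_all
    ultimately show "(\<lambda>kl. s * f kl) \<in> ?\<A>" by blast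
  next
    fix n :: nat and f and \<epsilon> :: real assume f: "\<And>j. j < n \<Longrightarrow> f j \<in> ?\<A>" and \<epsilon>: "0 < \<epsilon>"
    then have "\<forall>j. \<exists>i \<kappa> \<mu>. j < n \<longrightarrow> f j = a i \<kappa> \<mu> \<and> 0 < \<kappa> \<and> 0 < \<mu>" by blast
    then obtain i \<kappa> \<mu> where f: "\<And>j. j < n \<Longrightarrow> f j = a (i j) (\<kappa> j) (\<mu> j)"
        and pos: "\<And>j. j < n \<Longrightarrow> 0 < \<kappa> j" "\<And>j. j < n \<Longrightarrow> 0 < \<mu> j" by metis
    define G where "G k = (\<Sum>j<n. \<kappa> j * g (i j) k)" for k
    define H where "H l = (\<Sum>j<n. \<mu> j * h (i j) l)" for l
    have G_bdd: "bdd_above (G ` K)" unfolding G_def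
      by (intro bounded_imp_bdd_above bounded_sum_image) (use bounded_scaleR_comp[OF g(1)] in simp)
    have H_bdd: "bdd_above (H ` L)" unfolding H_def
      by (intro bounded_imp_bdd_above bounded_sum_image) (use bounded_scaleR_comp[OF h(1)] in simp)
    define A where "A = (SUP k\<in>K. G k)"
    define B where "B = (SUP l\<in>L. H l)"
    have GA: "G k \<le> A" if "k \<in> K" for k unfolding A_def by (intro cSUP_upper that G_bdd)
    have HB: "H l \<le> B" if "l \<in> L" for l unfolding B_def by (intro cSUP_upper that H_bdd)
    have "0 \<le> G k" if "k \<in> K" for k
      using that pos g(2) unfolding G_def by (intro sum_nonneg mult_nonneg_nonneg) (auto intro: less_imp_le)
    then have A: "0 \<le> A" using GA ne(1) by (meson all_not_in_conv order_trans)
    have "0 \<le> H l" if "l \<in> L" for l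
      using that pos h(2) unfolding H_def by (intro sum_nonneg mult_nonneg_nonneg) (auto intro: less_imp_le)
    then have B: "0 \<le> B" using HB ne(2) by (meson all_not_in_conv order_trans)
    \<comment> \<open>Points where both sums come within \<open>\<delta>\<close> of their suprema cost at most \<open>D * \<delta>\<close>, as \<open>\<alpha> + \<beta> = 1\<close>.\<close>
    define \<delta> where "\<delta> = \<epsilon> / (D + 1)"
    have \<delta>: "0 < \<delta>" "D * \<delta> < \<epsilon>" using \<epsilon> D by (auto simp: \<delta>_def field_simps)
    obtain k where k: "k \<in> K" "A - \<delta> < G k"
      using less_cSUP_iff[OF ne(1) G_bdd, of "A - \<delta>"] \<delta>(1) by (auto simp: A_def)
    obtain l where l: "l \<in> L" "B - \<delta> < H l"
      using less_cSUP_iff[OF ne(2) H_bdd, of "B - \<delta>"] \<delta>(1) by (auto simp: B_def)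
    have "(\<Sum>j<n. \<kappa> j powr \<alpha> * \<mu> j powr \<beta> * t (i j)) \<le> D * A powr \<alpha> * B powr \<beta>"
      using pos GA HB by (intro dom) (auto simp: G_def H_def)
    also have "\<dots> = D * (A powr \<alpha> * B powr \<beta>)" by simp
    also have "\<dots> \<le> D * (\<alpha> * A + \<beta> * B)"
      using A B ab D by (intro mult_left_mono weighted_am_gm)
    also have "\<dots> \<le> D * (\<alpha> * (G k + \<delta>) + \<beta> * (H l + \<delta>))"
      using ab D k l by (intro mult_left_mono add_mono) auto
    also have "\<dots> = D * (\<alpha> * G k + \<beta> * H l) + D * ((\<alpha> + \<beta>) * \<delta>)" by (simp add: algebra_simps)
    also have "\<dots> < D * (\<alpha> * G k + \<beta> * H l) + \<epsilon>" using \<delta> ab by simp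
    finally have "(\<Sum>j<n. \<kappa> j powr \<alpha> * \<mu> j powr \<beta> * t (i j)) < D * (\<alpha> * G k + \<beta> * H l) + \<epsilon>" .
    moreover have "(\<Sum>j<n. f j (k, l)) = D * (\<alpha> * G k + \<beta> * H l) - (\<Sum>j<n. \<kappa> j powr \<alpha> * \<mu> j powr \<beta> * t (i j))"
      by (simp add: f a_def G_def H_def sum_subtractf sum.distrib sum_distrib_left distrib_left)
    ultimately have "- \<epsilon> < (\<Sum>j<n. f j (k, l))" by simp
    then show "\<exists>kl\<in>K \<times> L. - \<epsilon> < (\<Sum>j<n. f j kl)" using k(1) l(1) by auto
  qed blast
  then obtain M where M: "mean_on (K \<times> L) M" and M_ge: "\<And>i \<kappa> \<mu>. 0 < \<kappa> \<Longrightarrow> 0 < \<mu> \<Longrightarrow> 0 \<le> M (a i \<kappa> \<mu>)"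
    by blast
  define M1 where "M1 f = M (\<lambda>kl. f (fst kl))" for f
  define M2 where "M2 f = M (\<lambda>kl. f (snd kl))" for f
  have "mean_on K M1" unfolding M1_def by (rule mean_on_image[OF M]) auto
  moreover have "mean_on L M2" unfolding M2_def by (rule mean_on_image[OF M]) auto
  moreover have "t i \<le> D * M1 (g i) powr \<alpha> * M2 (h i) powr \<beta>" for i
  proof -
    have nonneg: "0 \<le> M1 (g i)" "0 \<le> M2 (h i)"
      using mean_onD(3)[OF \<open>mean_on K M1\<close> g(1)] mean_onD(3)[OF \<open>mean_on L M2\<close> h(1)] g(2) h(2) by blast+
    \<comment> \<open>The means may vanish, so \<open>e\<close> is added to them before they are inverted.\<close>
    have eps: "t i \<le> D * (M1 (g i) + e) powr \<alpha> * (M2 (h i) + e) powr \<beta>" if e: "0 < e" for e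
    proof -
      define x where "x = M1 (g i) + e"
      define y where "y = M2 (h i) + e"
      have xy: "0 < x" "0 < y" "M1 (g i) / x \<le> 1" "M2 (h i) / y \<le> 1"
        using nonneg e by (auto simp: x_def y_def)
      let ?c = "(1 / x) powr \<alpha> * (1 / y) powr \<beta> * t i"
      have "M (a i (1 / x) (1 / y)) = D * (\<alpha> * (1 / x * M1 (g i)) + \<beta> * (1 / y * M2 (h i))) - ?c"
      proof -
        have "M (a i (1 / x) (1 / y)) = M (\<lambda>kl. D * (\<alpha> * (1 / x * g i (fst kl)) + \<beta> * (1 / y * h i (snd kl))) + - ?c)"
          by (intro arg_cong[of _ _ M]) (auto simp: a_def)
        also have "\<dots> = D * (\<alpha> * (1 / x * M1 (g i)) + \<beta> * (1 / y * M2 (h i))) + - ?c"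
          unfolding M1_def M2_def
          by (simp only: mean_onD(1,2,4)[OF M] comb_bdd const_bdd scale_bdd bounded_plus_comp g_bdd h_bdd)
        finally show ?thesis by simp
      qed
      then have "?c \<le> D * (\<alpha> * (M1 (g i) / x) + \<beta> * (M2 (h i) / y))"
        using M_ge[of "1 / x" "1 / y" i] xy by simp
      also have "\<dots> \<le> D * (\<alpha> * 1 + \<beta> * 1)"
        using xy ab D by (intro mult_left_mono add_mono) auto
      finally have "?c \<le> D" using ab by simp
      then show ?thesis
        unfolding x_def[symmetric] y_def[symmetric] using xy by (simp add: powr_divide field_simps)
    qed
    have ev: "\<forall>\<^sub>F e in at_right 0. t i \<le> D * (M1 (g i) + e) powr \<alpha> * (M2 (h i) + e) powr \<beta>"
      using eps by (auto simp: eventually_at_filter)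
    have "((\<lambda>e. D * (M1 (g i) + e) powr \<alpha> * (M2 (h i) + e) powr \<beta>) \<longlongrightarrow> D * (M1 (g i) + 0) powr \<alpha> * (M2 (h i) + 0) powr \<beta>) (at_right 0)"
      using ab nonneg
      by (intro tendsto_intros tendsto_powr') (auto simp: eventually_at_filter intro!: always_eventually)
    then have "t i \<le> D * (M1 (g i) + 0) powr \<alpha> * (M2 (h i) + 0) powr \<beta>"
      by (rule tendsto_lowerbound[OF _ ev]) simp
    then show ?thesis by simp
  qed
  ultimately show thesis using that by blast
qed

section \<open>Embeddings into spaces of bounded functions\<close>

instance bcontfun :: (metric_space, banach) banach ..

text \<open>
  The isometric embedding of Kuratowski, for a pseudometric: the differences \<open>\<rho> x y - \<rho> x0 y\<close> are
  bounded in \<open>y\<close> although the distances need not be. In this way a Lipschitz map into \<open>L\<^sub>p\<close> is replaced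
  by one into bounded functions on \<open>X\<close> with the same distances between its values.
\<close>

lemma sup_distance_embedding:
  fixes \<rho> :: "'a \<Rightarrow> 'a \<Rightarrow> real"
  assumes refl: "\<And>x. \<rho> x x = 0" and sym: "\<And>x y. \<rho> x y = \<rho> y x"
    and tri: "\<And>x y z. \<rho> x z \<le> \<rho> x y + \<rho> y z"
  obtains S :: "'a \<Rightarrow> ('a discrete \<Rightarrow>\<^sub>C real)" where "S x0 = 0" "\<And>x y. norm (S x - S y) = \<rho> x y"
proof -
  define S where "S x = bfun (\<lambda>y. \<rho> x y - \<rho> x0 y)" for x
  have abs_le: "\<bar>\<rho> x z - \<rho> y z\<bar> \<le> \<rho> x y" for x y z
    using tri[of x z y] tri[of y z x] sym[of x y] by linarith
  have app: "apply_bcontfun (S x) d = \<rho> x (of_discrete d) - \<rho> x0 (of_discrete d)" for x d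
    unfolding S_def using abs_le[of x _ x0] by (intro apply_bfun) (auto simp: bounded_iff)
  have "S x0 = 0" by (intro bcontfun_eqI) (simp add: app)
  moreover have "norm (S x - S y) = \<rho> x y" for x y
  proof (rule antisym)
    show "norm (S x - S y) \<le> \<rho> x y"
      by (intro norm_bound) (simp add: app abs_le)
    show "\<rho> x y \<le> norm (S x - S y)"
      using norm_bounded[of "S x - S y" "discrete y"] by (simp add: app discrete_inverse refl)
  qed
  ultimately show thesis by (rule that)
qed

text \<open>
  The linear counterpart: for each vector \<open>c\<close> choose a functional \<open>\<phi> c\<close> below \<open>n\<close> with
  \<open>\<phi> c c = n c\<close>, and send \<open>x\<close> to the family of all values \<open>\<phi> c x\<close>.
\<close>

lemma seminorm_embedding:
  fixes n :: "'v::real_vector \<Rightarrow> real"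
  assumes n: "sublinear n" and even: "\<And>x. n (- x) = n x"
  obtains R :: "'v \<Rightarrow> ('v discrete \<Rightarrow>\<^sub>C real)" where "linear R" "\<And>x. norm (R x) = n x"
proof -
  have "\<exists>\<phi>. linear \<phi> \<and> (\<forall>x. \<phi> x \<le> n x) \<and> n c \<le> \<phi> c" for c
  proof -
    let ?\<Psi> = "{(t *\<^sub>R c, t * n c) | t. t \<ge> 0}"
    have "\<exists>\<phi>. linear \<phi> \<and> (\<forall>x. \<phi> x \<le> n x) \<and> (\<forall>\<psi> s. (\<psi>, s) \<in> ?\<Psi> \<longrightarrow> s \<le> \<phi> \<psi>)"
      by (rule mazur_orlicz[OF n ray_in_product_cone[where a = c and s = "n c"]])
        (use sublinear_on_ray[OF n, of _ _ c] in blast)+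
    moreover have "(c, n c) \<in> ?\<Psi>" by (auto intro!: exI[of _ 1])
    ultimately show ?thesis by blast
  qed
  then obtain \<phi> where lin: "\<And>c. linear (\<phi> c)" and le: "\<And>c x. \<phi> c x \<le> n x" and ge: "\<And>c. n c \<le> \<phi> c c"
    by metis
  have abs_le: "\<bar>\<phi> c x\<bar> \<le> n x" for c x
    using le[of c x] le[of c "- x"] linear_neg[OF lin[of c], of x] even[of x] by linarith
  define R where "R x = bfun (\<lambda>c. \<phi> c x)" for x
  have app: "apply_bcontfun (R x) d = \<phi> (of_discrete d) x" for x d
    unfolding R_def using abs_le[of _ x] by (intro apply_bfun) (auto simp: bounded_iff)
  show thesis
  proof
    show "linear R"
      by (intro linearI bcontfun_eqI) (simp_all add: app linear_add[OF lin] linear_scale[OF lin])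
    show "norm (R x) = n x" for x
    proof (rule antisym)
      show "norm (R x) \<le> n x" by (intro norm_bound) (simp add: app abs_le)
      show "n x \<le> norm (R x)"
        using norm_bounded[of "R x" "discrete x"] ge[of x] by (simp add: app discrete_inverse)
    qed
  qed
qed

section \<open>Summing inequalities\<close>

lemma continuous_map_powr_abs:
  assumes "continuous_map Y euclideanreal w" "0 < a"
  shows "continuous_map Y euclideanreal (\<lambda>k. \<bar>w k\<bar> powr a)"
proof -
  have "continuous_on UNIV (\<lambda>s::real. \<bar>s\<bar> powr a)"
    using assms(2) by (intro continuous_on_powr' continuous_intros) auto
  then show ?thesis
    using continuous_map_compose[OF assms(1), of euclideanreal "\<lambda>s. \<bar>s\<bar> powr a"] by (simp add: comp_def)
qed

lemma continuous_map_powr_nonneg: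
  assumes "continuous_map Y euclideanreal w" "0 < a" "\<And>k. 0 \<le> w k"
  shows "continuous_map Y euclideanreal (\<lambda>k. w k powr a)"
  using continuous_map_powr_abs[OF assms(1,2)] assms(3) by simp

lemma bdd_above_weighted_powr_sum:
  fixes w :: "nat \<Rightarrow> 'c \<Rightarrow> real"
  assumes Y: "compact_space Y" and w: "\<And>j. continuous_map Y euclideanreal (w j)"
    and c: "\<And>j. 0 \<le> c j" and "0 < p" "0 < e"
  shows "bdd_above ((\<lambda>k. (\<Sum>j<m. c j * \<bar>w j k\<bar> powr p) powr e) ` topspace Y)"
proof -
  have "continuous_map Y euclideanreal (\<lambda>k. \<Sum>j<m. c j * \<bar>w j k\<bar> powr p)"
    using \<open>0 < p\<close>
    by (intro continuous_map_sum continuous_map_real_mult continuous_map_powr_abs w) auto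
  then have "continuous_map Y euclideanreal (\<lambda>k. (\<Sum>j<m. c j * \<bar>w j k\<bar> powr p) powr e)"
    using \<open>0 < e\<close> c by (intro continuous_map_powr_nonneg) (auto intro!: sum_nonneg)
  then show ?thesis by (intro bounded_imp_bdd_above continuous_map_bounded_image[OF Y])
qed

text \<open>
  An average over a probability measure is at most the supremum. This is why the map from the
  continuous functions on \<open>Y\<close> to \<open>L\<^sub>p (\<mu>)\<close> is \<open>p\<close>-summing with constant one.
\<close>

lemma powr_mean_le_SUP:
  fixes w :: "nat \<Rightarrow> 'c \<Rightarrow> real" and c :: "nat \<Rightarrow> real"
  assumes Y: "compact_space Y" and \<mu>: "regular_borel_prob Y \<mu>" and p: "0 < p"
    and w: "\<And>j. continuous_map Y euclideanreal (w j)" and c: "\<And>j. 0 \<le> c j"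
  shows "(\<Sum>j<m. c j * (\<integral>k. \<bar>w j k\<bar> powr p \<partial>\<mu>)) powr (1 / p)
    \<le> (SUP k\<in>topspace Y. (\<Sum>j<m. c j * \<bar>w j k\<bar> powr p) powr (1 / p))"
proof -
  interpret prob_space \<mu> using \<mu> by (simp add: regular_borel_prob_def)
  have sp: "space \<mu> = topspace Y" using \<mu> by (simp add: regular_borel_prob_def)
  define Z where "Z k = (\<Sum>j<m. c j * \<bar>w j k\<bar> powr p)" for k
  have Z_nonneg: "0 \<le> Z k" for k using c by (simp add: Z_def sum_nonneg)
  have "bdd_above ((\<lambda>k. Z k powr (1 / p)) ` topspace Y)"
    unfolding Z_def using p by (intro bdd_above_weighted_powr_sum Y w c) auto
  then have le: "Z k powr (1 / p) \<le> (SUP k\<in>topspace Y. Z k powr (1 / p))" if "k \<in> topspace Y" for k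
    by (rule cSUP_upper2[OF _ that order_refl])
  obtain k0 where "k0 \<in> topspace Y" using not_empty sp by blast
  then have S: "0 \<le> (SUP k\<in>topspace Y. Z k powr (1 / p))" using le[of k0] by (meson order_trans powr_ge_zero)
  have int: "integrable \<mu> (\<lambda>k. \<bar>w j k\<bar> powr p)" for j
    using p by (intro regular_borel_prob_integrable[OF \<mu>] continuous_map_bounded_image[OF Y] continuous_map_powr_abs w)
  have "(\<Sum>j<m. c j * (\<integral>k. \<bar>w j k\<bar> powr p \<partial>\<mu>)) = (\<integral>k. Z k \<partial>\<mu>)"
    unfolding Z_def using int by simp
  also have "\<dots> \<le> (\<integral>k. (SUP k\<in>topspace Y. Z k powr (1 / p)) powr p \<partial>\<mu>)"
  proof (rule integral_mono)
    show "integrable \<mu> Z" unfolding Z_def using int by simp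
    show "Z k \<le> (SUP k\<in>topspace Y. Z k powr (1 / p)) powr p" if "k \<in> space \<mu>" for k
    proof -
      have "Z k = (Z k powr (1 / p)) powr p" using Z_nonneg[of k] p by (simp add: powr_powr)
      also have "\<dots> \<le> (SUP k\<in>topspace Y. Z k powr (1 / p)) powr p"
        using le that sp p by (intro powr_mono2) auto
      finally show ?thesis .
    qed
  qed simp
  also have "\<dots> = (SUP k\<in>topspace Y. Z k powr (1 / p)) powr p" by (simp add: prob_space)
  finally have "(\<Sum>j<m. c j * (\<integral>k. \<bar>w j k\<bar> powr p \<partial>\<mu>)) powr (1 / p) \<le> ((SUP k\<in>topspace Y. Z k powr (1 / p)) powr p) powr (1 / p)"
    using p c by (intro powr_mono2 sum_nonneg) auto
  also have "\<dots> = (SUP k\<in>topspace Y. Z k powr (1 / p))" using S p by (simp add: powr_powr)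
  finally show ?thesis by (simp add: Z_def)
qed

text \<open>
  Passing from the \<open>p\<close>-th root to the power \<open>e / p\<close>. Only one of the two inequalities between the
  power of a supremum and the supremum of the powers is needed, and it requires that the latter
  supremum is finite.
\<close>

lemma powr_SUP_le:
  fixes a :: "'k \<Rightarrow> real"
  assumes "K \<noteq> {}" and bdd: "bdd_above ((\<lambda>k. a k powr (e / p)) ` K)" and "0 < e" "0 < p"
    and C: "0 \<le> C" and le: "l powr (1 / p) \<le> C * (SUP k\<in>K. a k powr (1 / p))"
  shows "l powr (e / p) \<le> C powr e * (SUP k\<in>K. a k powr (e / p))"
proof -
  define s where "s = (SUP k\<in>K. a k powr (e / p))"
  have up: "a k powr (e / p) \<le> s" if "k \<in> K" for k unfolding s_def by (intro cSUP_upper bdd that)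
  then have s: "0 \<le> s" using assms(1) by (meson all_not_in_conv order_trans powr_ge_zero)
  have "a k powr (1 / p) \<le> s powr (1 / e)" if "k \<in> K" for k
  proof -
    have "a k powr (1 / p) = (a k powr (e / p)) powr (1 / e)" using \<open>0 < e\<close> by (simp add: powr_powr)
    also have "\<dots> \<le> s powr (1 / e)" using up[OF that] \<open>0 < e\<close> by (intro powr_mono2) auto
    finally show ?thesis .
  qed
  then have "(SUP k\<in>K. a k powr (1 / p)) \<le> s powr (1 / e)" using assms(1) by (intro cSUP_least)
  then have "l powr (1 / p) \<le> C * s powr (1 / e)" using le C by (meson mult_left_mono order_trans)
  then have "(l powr (1 / p)) powr e \<le> (C * s powr (1 / e)) powr e" using \<open>0 < e\<close> by (intro powr_mono2) auto
  also have "\<dots> = C powr e * s" using C s \<open>0 < e\<close> by (simp add: powr_mult powr_powr)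
  finally show ?thesis by (simp add: powr_powr s_def)
qed

text \<open>
  The factor \<open>d powr \<theta>\<close> of an interpolated term can be absorbed into the weight. This reduces
  the interpolated inequalities to the plain summing inequalities with changed weights.
\<close>

lemma interpolated_powr:
  fixes s N d \<theta> p :: real
  assumes "0 \<le> s" "0 \<le> N" "0 \<le> d" "\<theta> < 1"
  shows "(s * N powr (1 - \<theta>) * d powr \<theta>) powr (p / (1 - \<theta>)) = ((s * d powr \<theta>) powr (1 / (1 - \<theta>))) powr p * N powr p"
  using assms by (simp add: powr_mult powr_powr mult_ac)

lemma interpolated_powr':
  fixes N d \<theta> p :: real
  assumes "0 \<le> N" "0 \<le> d" "\<theta> < 1"
  shows "(N powr (1 - \<theta>) * d powr \<theta>) powr (p / (1 - \<theta>)) = ((d powr \<theta>) powr (1 / (1 - \<theta>))) powr p * N powr p"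
  using interpolated_powr[of 1 N d \<theta> p] assms by simp

text \<open>
  In the applications \<open>b\<close> is a supremum of nonnegative numbers whose finiteness is not at hand, and
  the supremum of an unbounded set may be negative. Hence the distinction by the sign of \<open>b\<close>.
\<close>

lemma Inf_constant_attained:
  fixes \<C> :: "real set"
  assumes "\<C> \<noteq> {}" "\<And>C. C \<in> \<C> \<Longrightarrow> 0 \<le> C" "\<And>C. C \<in> \<C> \<Longrightarrow> a \<le> C * b" "0 \<le> a"
  shows "a \<le> Inf \<C> * b"
proof -
  consider "b < 0" | "b = 0" | "0 < b" by linarith
  then show ?thesis
  proof cases
    case 1
    have "C = 0" if "C \<in> \<C>" for C
      using assms(2,3)[OF that] assms(4) 1 by (metis linorder_not_less mult_pos_neg nle_le order_antisym order_trans)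
    then have "\<C> = {0}" using assms(1) by blast
    then show ?thesis using assms(3)[of 0] by simp
  next
    case 2
    then show ?thesis using assms(1,3) by force
  next
    case 3
    then have "a / b \<le> Inf \<C>" using assms(1,3) by (intro cInf_greatest) (auto simp: divide_le_eq)
    then show ?thesis using 3 by (simp add: divide_le_eq)
  qed
qed

lemma lip_summing_const_norm:
  assumes "lip_summing_const p x0 N S C"
  shows "lip_summing_const p x0 N S (lip_summing_norm p x0 N S)"
  unfolding lip_summing_const_def[of p x0 N S "lip_summing_norm p x0 N S"]
proof (intro conjI allI impI)
  show "0 \<le> lip_summing_norm p x0 N S"
    unfolding lip_summing_norm_def
    by (intro cInf_greatest) (use assms in blast, simp add: lip_summing_const_def)
next
  fix m :: nat and x' x'' and w :: "nat \<Rightarrow> real" assume w: "\<forall>j<m. 0 < w j"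
  show "(\<Sum>j<m. w j powr p * N (S (x' j) - S (x'' j)) powr p) powr (1 / p)
    \<le> lip_summing_norm p x0 N S * (SUP f\<in>lip_ball x0. (\<Sum>j<m. w j powr p * \<bar>f (x' j) - f (x'' j)\<bar> powr p) powr (1 / p))"
    unfolding lip_summing_norm_def
  proof (intro Inf_constant_attained)
    show "{C. lip_summing_const p x0 N S C} \<noteq> {}" using assms by blast
    show "(\<Sum>j<m. w j powr p * N (S (x' j) - S (x'' j)) powr p) powr (1 / p)
        \<le> C * (SUP f\<in>lip_ball x0. (\<Sum>j<m. w j powr p * \<bar>f (x' j) - f (x'' j)\<bar> powr p) powr (1 / p))"
      if "C \<in> {C. lip_summing_const p x0 N S C}" for C
      using that w by (simp add: lip_summing_const_def)
  qed (auto simp: lip_summing_const_def)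
qed

lemma abs_summing_const_norm:
  fixes R :: "'e::real_normed_vector \<Rightarrow> 'u::real_vector"
  assumes "abs_summing_const q N R C"
  shows "abs_summing_const q N R (abs_summing_norm q N R)"
  unfolding abs_summing_const_def[of q N R "abs_summing_norm q N R"]
proof (intro conjI allI)
  show "0 \<le> abs_summing_norm q N R"
    unfolding abs_summing_norm_def using assms by (intro cInf_greatest) (auto simp: abs_summing_const_def)
  show "(\<Sum>j<m. N (R (x j)) powr q) powr (1 / q)
    \<le> abs_summing_norm q N R * (SUP \<xi>\<in>cball (0 :: 'e dual) 1. (\<Sum>j<m. \<bar>blinfun_apply \<xi> (x j)\<bar> powr q) powr (1 / q))" for m :: nat and x
    unfolding abs_summing_norm_def
  proof (rule Inf_constant_attained)
    show "{C. abs_summing_const q N R C} \<noteq> {}" using assms by blast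
    show "(\<Sum>j<m. N (R (x j)) powr q) powr (1 / q)
        \<le> C * (SUP \<xi>\<in>cball (0 :: 'e dual) 1. (\<Sum>j<m. \<bar>blinfun_apply \<xi> (x j)\<bar> powr q) powr (1 / q))"
      if "C \<in> {C. abs_summing_const q N R C}" for C
      using that by (simp add: abs_summing_const_def)
  qed (auto simp: abs_summing_const_def)
qed

lemma lip_summing_norm_le: "lip_summing_const p x0 N S C \<Longrightarrow> lip_summing_norm p x0 N S \<le> C"
  unfolding lip_summing_norm_def by (intro cInf_lower bdd_belowI[of _ 0]) (auto simp: lip_summing_const_def)

lemma abs_summing_norm_le: "abs_summing_const q N R C \<Longrightarrow> abs_summing_norm q N R \<le> C"
  unfolding abs_summing_norm_def by (intro cInf_lower bdd_belowI[of _ 0]) (auto simp: abs_summing_const_def)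

text \<open>
  Summing inequalities are only given for positive weights. A term of weight zero is replaced by the
  term of weight one whose two points are both the base point.
\<close>

lemma lip_summing_nonneg_weights:
  fixes m :: nat
  assumes S: "lip_summing_const p x0 N S C" and "N 0 = 0" and w: "\<And>j. 0 \<le> w j"
  shows "(\<Sum>j<m. w j powr p * N (S (x' j) - S (x'' j)) powr p) powr (1 / p)
    \<le> C * (SUP f\<in>lip_ball x0. (\<Sum>j<m. w j powr p * \<bar>f (x' j) - f (x'' j)\<bar> powr p) powr (1 / p))"
proof -
  define v where "v j = (if w j = 0 then 1 else w j)" for j
  define y' where "y' j = (if w j = 0 then x0 else x' j)" for j
  define y'' where "y'' j = (if w j = 0 then x0 else x'' j)" for j
  have "\<forall>j<m. 0 < v j" using w by (auto simp: v_def less_le)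
  then have "(\<Sum>j<m. v j powr p * N (S (y' j) - S (y'' j)) powr p) powr (1 / p)
    \<le> C * (SUP f\<in>lip_ball x0. (\<Sum>j<m. v j powr p * \<bar>f (y' j) - f (y'' j)\<bar> powr p) powr (1 / p))"
    using S unfolding lip_summing_const_def by blast
  moreover have "v j powr p * N (S (y' j) - S (y'' j)) powr p = w j powr p * N (S (x' j) - S (x'' j)) powr p" for j
    using \<open>N 0 = 0\<close> by (simp add: v_def y'_def y''_def)
  moreover have "v j powr p * \<bar>f (y' j) - f (y'' j)\<bar> powr p = w j powr p * \<bar>f (x' j) - f (x'' j)\<bar> powr p" for j and f :: "'a \<Rightarrow> real"
    by (simp add: v_def y'_def y''_def)
  ultimately show ?thesis by simp
qed

lemma bdd_above_delta_lip:
  fixes m :: nat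
  assumes "0 < p" "\<theta> < 1"
  shows "bdd_above ((\<lambda>f. (\<Sum>j<m. w j powr p * \<bar>f (x' j) - f (x'' j)\<bar> powr p) powr ((1 - \<theta>) / p)) ` lip_ball x0)"
proof -
  have "bdd_above ((\<lambda>f. (\<Sum>j<m. w j powr p * \<bar>f (x' j) - f (x'' j)\<bar> powr p) powr ((1 - \<theta>) / p)) ` topspace (lip_ball_topology x0))"
    using assms
    by (intro bdd_above_weighted_powr_sum compact_space_lip_ball continuous_map_diff continuous_map_lip_ball_eval) auto
  then show ?thesis by simp
qed

lemma bdd_above_delta_lin:
  fixes x :: "nat \<Rightarrow> 'e::real_normed_vector"
  assumes "0 < q" "\<nu> < 1"
  shows "bdd_above ((\<lambda>\<xi>. (\<Sum>j<m. w j powr q * \<bar>blinfun_apply \<xi> (x j)\<bar> powr q) powr ((1 - \<nu>) / q)) ` cball (0 :: 'e dual) 1)"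
proof -
  have "bdd_above ((\<lambda>\<xi>. (\<Sum>j<m. w j powr q * \<bar>blinfun_apply \<xi> (x j)\<bar> powr q) powr ((1 - \<nu>) / q)) ` topspace (dual_ball_topology :: 'e dual topology))"
    using assms
    by (intro bdd_above_weighted_powr_sum compact_space_dual_ball continuous_map_dual_ball_eval) auto
  then show ?thesis by simp
qed

lemma lip_summing_interpolated:
  assumes S: "lip_summing_const p x0 N S C" and N: "N 0 = 0" "\<And>j. 0 \<le> N (S (x' j) - S (x'' j))"
    and p: "0 < p" "\<theta> < 1"
  shows "(\<Sum>j<m. (\<bar>\<sigma> j\<bar> * N (S (x' j) - S (x'' j)) powr (1 - \<theta>) * dist (x' j) (x'' j) powr \<theta>) powr (p / (1 - \<theta>))) powr ((1 - \<theta>) / p)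
    \<le> C powr (1 - \<theta>) * delta_lip p \<theta> x0 m \<sigma> x' x''"
proof -
  define w where "w j = (\<bar>\<sigma> j\<bar> * dist (x' j) (x'' j) powr \<theta>) powr (1 / (1 - \<theta>))" for j
  have d: "delta_lip p \<theta> x0 m \<sigma> x' x'' = (SUP f\<in>lip_ball x0. (\<Sum>j<m. w j powr p * \<bar>f (x' j) - f (x'' j)\<bar> powr p) powr ((1 - \<theta>) / p))"
    unfolding delta_lip_def w_def using p(2) by (simp add: interpolated_powr)
  have "(\<Sum>j<m. w j powr p * N (S (x' j) - S (x'' j)) powr p) powr ((1 - \<theta>) / p) \<le> C powr (1 - \<theta>) * delta_lip p \<theta> x0 m \<sigma> x' x''"
    unfolding d
  proof (rule powr_SUP_le)
    show "lip_ball x0 \<noteq> {}" using zero_in_lip_ball by blast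
    show "0 \<le> C" using S by (simp add: lip_summing_const_def)
    show "(\<Sum>j<m. w j powr p * N (S (x' j) - S (x'' j)) powr p) powr (1 / p)
        \<le> C * (SUP f\<in>lip_ball x0. (\<Sum>j<m. w j powr p * \<bar>f (x' j) - f (x'' j)\<bar> powr p) powr (1 / p))"
      by (intro lip_summing_nonneg_weights[OF S N(1)]) (simp add: w_def)
  qed (use p bdd_above_delta_lip in auto)
  then show ?thesis unfolding w_def using p(2) N(2) by (simp add: interpolated_powr)
qed

lemma abs_summing_interpolated:
  fixes R :: "'e::real_normed_vector \<Rightarrow> 'u::real_vector"
  assumes R: "abs_summing_const q N R C"
    and N: "\<And>a x. N (R (a *\<^sub>R x)) = \<bar>a\<bar> * N (R x)" "\<And>x. 0 \<le> N (R x)"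
    and q: "0 < q" "\<nu> < 1"
  shows "(\<Sum>j<m. (N (R (x j)) powr (1 - \<nu>) * norm (x j) powr \<nu>) powr (q / (1 - \<nu>))) powr ((1 - \<nu>) / q)
    \<le> C powr (1 - \<nu>) * delta_lin q \<nu> m x"
proof -
  define w where "w j = (norm (x j) powr \<nu>) powr (1 / (1 - \<nu>))" for j
  have w: "0 \<le> w j" for j by (simp add: w_def)
  have d: "delta_lin q \<nu> m x = (SUP \<xi>\<in>cball (0 :: 'e dual) 1. (\<Sum>j<m. w j powr q * \<bar>blinfun_apply \<xi> (x j)\<bar> powr q) powr ((1 - \<nu>) / q))"
    unfolding delta_lin_def w_def using q(2) by (simp add: interpolated_powr')
  have "(\<Sum>j<m. w j powr q * N (R (x j)) powr q) powr ((1 - \<nu>) / q) \<le> C powr (1 - \<nu>) * delta_lin q \<nu> m x"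
    unfolding d
  proof (rule powr_SUP_le)
    show "0 \<le> C" using R by (simp add: abs_summing_const_def)
    \<comment> \<open>By homogeneity the weights can be moved into the vectors.\<close>
    have "(\<Sum>j<m. N (R (w j *\<^sub>R x j)) powr q) powr (1 / q)
        \<le> C * (SUP \<xi>\<in>cball (0 :: 'e dual) 1. (\<Sum>j<m. \<bar>blinfun_apply \<xi> (w j *\<^sub>R x j)\<bar> powr q) powr (1 / q))"
      using R[unfolded abs_summing_const_def, THEN conjunct2, rule_format, where x = "\<lambda>j. w j *\<^sub>R x j" and m = m] .
    then show "(\<Sum>j<m. w j powr q * N (R (x j)) powr q) powr (1 / q)
        \<le> C * (SUP \<xi>\<in>cball (0 :: 'e dual) 1. (\<Sum>j<m. w j powr q * \<bar>blinfun_apply \<xi> (x j)\<bar> powr q) powr (1 / q))"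
      using w N(2) by (simp add: N(1) blinfun.scaleR_right abs_mult powr_mult)
  qed (use q bdd_above_delta_lin in auto)
  then show ?thesis unfolding w_def using q(2) N(2) by (simp add: interpolated_powr')
qed

section \<open>From domination to sequences, to integrals and back\<close>

lemma banach_onD:
  assumes "banach_on V N"
  shows "N 0 = 0" and "x \<in> V \<Longrightarrow> 0 \<le> N x" and "x \<in> V \<Longrightarrow> N (a *\<^sub>R x) = \<bar>a\<bar> * N x"
    and "x \<in> V \<Longrightarrow> y \<in> V \<Longrightarrow> x - y \<in> V"
  using assms subspace_0[of V] subspace_diff[of V] unfolding banach_on_def by auto

text \<open>
  The domination bounds each term by a product of a term in \<open>S\<close> and a term in \<open>R\<close>. The relation
  between the exponents is the one of Hoelder's inequality, which separates the two factors, and each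
  factor is estimated by its summing inequality.
\<close>

lemma dominating_imp_sequence_dominated:
  fixes T :: "'a::metric_space \<Rightarrow> 'b::banach" and NG NH :: "'u::real_vector \<Rightarrow> real"
  assumes dom: "dominating p \<theta> q \<nu> x0 T G NG S H NH R C"
    and p: "0 < p" "\<theta> < 1" and q: "0 < q" "\<nu> < 1" and r': "0 < r'" "1 / r' = (1 - \<theta>) / p + (1 - \<nu>) / q"
  shows "sequence_dominated p \<theta> q \<nu> r' x0 T
    (C * lip_summing_norm p x0 NG S powr (1 - \<theta>) * abs_summing_norm q NH R powr (1 - \<nu>))"
  unfolding sequence_dominated_def
proof (intro conjI allI)
  note d = dom[unfolded dominating_def]
  have G: "banach_on G NG" and H: "banach_on H NH" and C: "C > 0" using d by auto
  have S: "range S \<subseteq> G" and R: "linear R" "range R \<subseteq> H"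
    using d by (auto simp: lip_summing_def lip0_into_def abs_summing_def)
  obtain K where "lip_summing_const p x0 NG S K" using d by (auto simp: lip_summing_def)
  note Sc = lip_summing_const_norm[OF this]
  obtain K where "abs_summing_const q NH R K" using d by (auto simp: abs_summing_def)
  note Rc = abs_summing_const_norm[OF this]
  have NS: "0 \<le> NG (S x - S y)" for x y using S by (intro banach_onD(2,4)[OF G]) auto
  have NR: "0 \<le> NH (R b)" for b using R(2) by (intro banach_onD(2)[OF H]) auto
  have NR_scale: "NH (R (a *\<^sub>R b)) = \<bar>a\<bar> * NH (R b)" for a b
    using R(2) linear_scale[OF R(1)] banach_onD(3)[OF H, of "R b" a] by auto
  let ?s = "lip_summing_norm p x0 NG S" and ?t = "abs_summing_norm q NH R"
  show "0 \<le> C * ?s powr (1 - \<theta>) * ?t powr (1 - \<nu>)" using C by simp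
  fix m :: nat and x' x'' \<sigma> and b :: "nat \<Rightarrow> 'b dual"
  define X where "X j = \<bar>\<sigma> j\<bar> * NG (S (x' j) - S (x'' j)) powr (1 - \<theta>) * dist (x' j) (x'' j) powr \<theta>" for j :: nat
  define Y where "Y j = NH (R (b j)) powr (1 - \<nu>) * norm (b j) powr \<nu>" for j
  have XY: "0 \<le> X j" "0 \<le> Y j" for j by (simp_all add: X_def Y_def)
  have "\<bar>\<sigma> j * blinfun_apply (b j) (T (x' j) - T (x'' j))\<bar> \<le> C * (X j * Y j)" for j
  proof -
    have "\<bar>blinfun_apply (b j) (T (x' j) - T (x'' j))\<bar>
        \<le> C * dist (x' j) (x'' j) powr \<theta> * NG (S (x' j) - S (x'' j)) powr (1 - \<theta>)
            * norm (b j) powr \<nu> * NH (R (b j)) powr (1 - \<nu>)" using d by blast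
    from mult_left_mono[OF this, of "\<bar>\<sigma> j\<bar>"] show ?thesis by (simp add: abs_mult X_def Y_def mult_ac)
  qed
  then have "(\<Sum>j<m. \<bar>\<sigma> j * blinfun_apply (b j) (T (x' j) - T (x'' j))\<bar> powr r') \<le> (\<Sum>j<m. (C * (X j * Y j)) powr r')"
    using r' by (intro sum_mono powr_mono2) auto
  also have "\<dots> = C powr r' * (\<Sum>j<m. (X j * Y j) powr r')"
    using C XY by (simp add: powr_mult sum_distrib_left)
  finally have "(\<Sum>j<m. \<bar>\<sigma> j * blinfun_apply (b j) (T (x' j) - T (x'' j))\<bar> powr r') powr (1 / r')
      \<le> (C powr r' * (\<Sum>j<m. (X j * Y j) powr r')) powr (1 / r')"
    using r'(1) by (intro powr_mono2 sum_nonneg) auto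
  also have "\<dots> = C * (\<Sum>j<m. (X j * Y j) powr r') powr (1 / r')"
    using C r'(1) by (simp add: powr_mult powr_powr sum_nonneg)
  also have "(\<Sum>j<m. (X j * Y j) powr r') powr (1 / r')
      \<le> (\<Sum>j<m. X j powr (p / (1 - \<theta>))) powr (1 / (p / (1 - \<theta>))) * (\<Sum>j<m. Y j powr (q / (1 - \<nu>))) powr (1 / (q / (1 - \<nu>)))"
    using XY p q r' by (intro Holder_sum_powr) auto
  also have "\<dots> \<le> (?s powr (1 - \<theta>) * delta_lip p \<theta> x0 m \<sigma> x' x'') * (?t powr (1 - \<nu>) * delta_lin q \<nu> m b)"
  proof (intro mult_mono)
    show le1: "(\<Sum>j<m. X j powr (p / (1 - \<theta>))) powr (1 / (p / (1 - \<theta>))) \<le> ?s powr (1 - \<theta>) * delta_lip p \<theta> x0 m \<sigma> x' x''"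
      using lip_summing_interpolated[OF Sc banach_onD(1)[OF G] NS p] by (simp add: X_def)
    show "(\<Sum>j<m. Y j powr (q / (1 - \<nu>))) powr (1 / (q / (1 - \<nu>))) \<le> ?t powr (1 - \<nu>) * delta_lin q \<nu> m b"
      using abs_summing_interpolated[OF Rc NR_scale NR q] by (simp add: Y_def)
    show "0 \<le> ?s powr (1 - \<theta>) * delta_lip p \<theta> x0 m \<sigma> x' x''"
      using le1 by (meson order_trans powr_ge_zero)
  qed auto
  finally show "(\<Sum>j<m. \<bar>\<sigma> j * blinfun_apply (b j) (T (x' j) - T (x'' j))\<bar> powr r') powr (1 / r')
      \<le> C * ?s powr (1 - \<theta>) * ?t powr (1 - \<nu>) * delta_lip p \<theta> x0 m \<sigma> x' x'' * delta_lin q \<nu> m b"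
    using C by (simp add: mult_ac mult_left_mono)
qed

lemma continuous_map_interpolated_powr:
  assumes "continuous_map Y euclideanreal w" "0 < p" "\<theta> < 1" "0 \<le> d"
  shows "continuous_map Y euclideanreal (\<lambda>k. (\<bar>w k\<bar> powr (1 - \<theta>) * d powr \<theta>) powr (p / (1 - \<theta>)))"
proof -
  have "(\<bar>w k\<bar> powr (1 - \<theta>) * d powr \<theta>) powr (p / (1 - \<theta>)) = ((d powr \<theta>) powr (1 / (1 - \<theta>))) powr p * \<bar>w k\<bar> powr p" for k
    using assms by (intro interpolated_powr') auto
  then show ?thesis
    using assms by (simp add: continuous_map_real_mult continuous_map_powr_abs)
qed

text \<open>
  The inequality for finite sequences, raised to the power \<open>r'\<close>, is the hypothesis of the domination
  theorem for the compact balls, with exponents \<open>r' / u\<close> and \<open>r' / v\<close> that sum to one. The weights come from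
  the freedom to rescale: \<open>\<kappa>\<close> is absorbed into the scalars \<open>\<sigma>\<close>, and \<open>\<mu>\<close> into the functionals \<open>b\<close>, on which the
  second integrand is homogeneous of degree \<open>v\<close>. The means are then replaced by measures.
\<close>

lemma sequence_dominated_imp_integral_dominated:
  fixes T :: "'a::metric_space \<Rightarrow> 'b::banach"
  assumes seq: "sequence_dominated p \<theta> q \<nu> r' x0 T C"
    and p: "0 < p" "\<theta> < 1" and q: "0 < q" "\<nu> < 1" and r': "0 < r'" "1 / r' = (1 - \<theta>) / p + (1 - \<nu>) / q"
  shows "integral_dominated p \<theta> q \<nu> x0 T C"
proof -
  have C: "0 \<le> C" using seq by (simp add: sequence_dominated_def)
  define u where "u = p / (1 - \<theta>)"
  define v where "v = q / (1 - \<nu>)"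
  have uv: "0 < u" "0 < v" using p q by (auto simp: u_def v_def)
  have inv: "1 / u = (1 - \<theta>) / p" "1 / v = (1 - \<nu>) / q" by (simp_all add: u_def v_def)
  have "r' / u + r' / v = r' * (1 / u + 1 / v)" by (simp add: distrib_left)
  also have "\<dots> = 1" using r' by (simp add: inv flip: r'(2))
  finally have ab: "r' / u + r' / v = 1" .
  define t where "t i = (case i of (x', x'', b) \<Rightarrow> \<bar>blinfun_apply b (T x' - T x'')\<bar> powr r')" for i :: "'a \<times> 'a \<times> 'b dual"
  define g where "g i f = (case i of (x', x'', b) \<Rightarrow> (\<bar>f x' - f x''\<bar> powr (1 - \<theta>) * dist x' x'' powr \<theta>) powr u)"
    for i :: "'a \<times> 'a \<times> 'b dual" and f :: "'a \<Rightarrow> real"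
  define h where "h i \<xi> = (case i of (x', x'', b) \<Rightarrow> (\<bar>blinfun_apply \<xi> b\<bar> powr (1 - \<nu>) * norm b powr \<nu>) powr v)"
    for i :: "'a \<times> 'a \<times> 'b dual" and \<xi> :: "'b dual dual"
  have g_cont: "continuous_map (lip_ball_topology x0) euclideanreal (g i)" for i
    unfolding g_def u_def using p
    by (cases i) (auto intro!: continuous_map_interpolated_powr continuous_map_diff continuous_map_lip_ball_eval)
  have h_cont: "continuous_map dual_ball_topology euclideanreal (h i)" for i
    unfolding h_def v_def using q
    by (cases i) (auto intro!: continuous_map_interpolated_powr continuous_map_dual_ball_eval)
  have g_nonneg: "0 \<le> g i f" and h_nonneg: "0 \<le> h i \<xi>" for i f \<xi>
    by (auto simp: g_def h_def split: prod.split)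
  have "\<exists>M N. mean_on (lip_ball x0) M \<and> mean_on (cball 0 1) N \<and>
      (\<forall>i. t i \<le> C powr r' * M (g i) powr (r' / u) * N (h i) powr (r' / v))"
  proof (rule bilinear_domination_by_means[of "lip_ball x0" "cball 0 1 :: 'b dual dual set" "r' / u" "r' / v" "C powr r'" g h t])
    show "lip_ball x0 \<noteq> {}" using zero_in_lip_ball by blast
    show "bounded (g i ` lip_ball x0)" for i
      using continuous_map_bounded_image[OF compact_space_lip_ball g_cont] by simp
    show "bounded (h i ` cball 0 1)" for i
      using continuous_map_bounded_image[OF compact_space_dual_ball h_cont] by simp
  next
    fix n :: nat and i :: "nat \<Rightarrow> 'a \<times> 'a \<times> 'b dual" and \<kappa> \<mu> :: "nat \<Rightarrow> real" and A B :: real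
    assume pos: "\<And>j. j < n \<Longrightarrow> 0 < \<kappa> j" "\<And>j. j < n \<Longrightarrow> 0 < \<mu> j"
      and A: "\<And>f. f \<in> lip_ball x0 \<Longrightarrow> (\<Sum>j<n. \<kappa> j * g (i j) f) \<le> A"
      and B: "\<And>\<xi>. \<xi> \<in> cball 0 1 \<Longrightarrow> (\<Sum>j<n. \<mu> j * h (i j) \<xi>) \<le> B"
    define x' where "x' j = fst (i j)" for j
    define x'' where "x'' j = fst (snd (i j))" for j
    define b where "b j = snd (snd (i j))" for j
    have i: "i j = (x' j, x'' j, b j)" for j by (simp add: x'_def x''_def b_def)
    \<comment> \<open>The terms of the two sequence norms are homogeneous of degree \<open>u\<close> in the scalars and \<open>v\<close> in the functionals.\<close>
    define \<sigma> where "\<sigma> j = \<kappa> j powr (1 / u)" for j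
    define c where "c j = \<mu> j powr (1 / v) *\<^sub>R b j" for j
    have A0: "0 \<le> A"
      by (rule order_trans[OF sum_nonneg A[OF zero_in_lip_ball]]) (simp add: pos(1) g_nonneg less_imp_le)
    have B0: "0 \<le> B"
      by (rule order_trans[OF sum_nonneg B[of 0]]) (simp_all add: pos(2) h_nonneg less_imp_le)
    have lip: "delta_lip p \<theta> x0 n \<sigma> x' x'' \<le> A powr (1 / u)"
      unfolding delta_lip_def inv[symmetric] u_def[symmetric]
    proof (rule cSUP_least)
      fix f assume f: "f \<in> lip_ball x0"
      have "(\<Sum>j<n. (\<bar>\<sigma> j\<bar> * \<bar>f (x' j) - f (x'' j)\<bar> powr (1 - \<theta>) * dist (x' j) (x'' j) powr \<theta>) powr u) = (\<Sum>j<n. \<kappa> j * g (i j) f)"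
      proof (intro sum.cong refl)
        fix j assume "j \<in> {..<n}"
        then show "(\<bar>\<sigma> j\<bar> * \<bar>f (x' j) - f (x'' j)\<bar> powr (1 - \<theta>) * dist (x' j) (x'' j) powr \<theta>) powr u = \<kappa> j * g (i j) f"
          using pos(1)[of j] uv by (simp add: \<sigma>_def g_def i powr_mult powr_powr mult_ac)
      qed
      then show "(\<Sum>j<n. (\<bar>\<sigma> j\<bar> * \<bar>f (x' j) - f (x'' j)\<bar> powr (1 - \<theta>) * dist (x' j) (x'' j) powr \<theta>) powr u) powr (1 / u) \<le> A powr (1 / u)"
        using A[OF f] uv by (intro powr_mono2 sum_nonneg) auto
    qed (use zero_in_lip_ball in blast)
    have lin: "delta_lin q \<nu> n c \<le> B powr (1 / v)"
      unfolding delta_lin_def inv[symmetric] v_def[symmetric]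
    proof (rule cSUP_least)
      fix \<xi> :: "'b dual dual" assume \<xi>: "\<xi> \<in> cball 0 1"
      have "(\<Sum>j<n. (\<bar>blinfun_apply \<xi> (c j)\<bar> powr (1 - \<nu>) * norm (c j) powr \<nu>) powr v) = (\<Sum>j<n. \<mu> j * h (i j) \<xi>)"
      proof (intro sum.cong refl)
        fix j assume "j \<in> {..<n}"
        then have mu: "0 < \<mu> j" using pos(2) by simp
        let ?m = "\<mu> j powr (1 / v)"
        have "\<bar>blinfun_apply \<xi> (c j)\<bar> powr (1 - \<nu>) * norm (c j) powr \<nu>
            = (?m powr (1 - \<nu>) * ?m powr \<nu>) * (\<bar>blinfun_apply \<xi> (b j)\<bar> powr (1 - \<nu>) * norm (b j) powr \<nu>)"
          by (simp only: c_def blinfun.scaleR_right real_scaleR_def norm_scaleR abs_mult powr_mult abs_ge_zero powr_ge_zero norm_ge_zero abs_of_nonneg mult_ac)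
        also have "?m powr (1 - \<nu>) * ?m powr \<nu> = ?m" using mu by (simp flip: powr_add)
        finally show "(\<bar>blinfun_apply \<xi> (c j)\<bar> powr (1 - \<nu>) * norm (c j) powr \<nu>) powr v = \<mu> j * h (i j) \<xi>"
          using mu uv by (simp add: h_def i powr_mult powr_powr)
      qed
      then show "(\<Sum>j<n. (\<bar>blinfun_apply \<xi> (c j)\<bar> powr (1 - \<nu>) * norm (c j) powr \<nu>) powr v) powr (1 / v) \<le> B powr (1 / v)"
        using B[OF \<xi>] uv by (intro powr_mono2 sum_nonneg) auto
    qed simp
    have "0 \<le> delta_lin q \<nu> n c"
      unfolding delta_lin_def
    proof (rule cSUP_upper2[of _ _ 0])
      show "bdd_above ((\<lambda>\<xi>. (\<Sum>j<n. (\<bar>blinfun_apply \<xi> (c j)\<bar> powr (1 - \<nu>) * norm (c j) powr \<nu>) powr (q / (1 - \<nu>))) powr ((1 - \<nu>) / q)) ` cball 0 1)"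
        using bdd_above_delta_lin[OF q, where m = n and w = "\<lambda>j. (norm (c j) powr \<nu>) powr (1 / (1 - \<nu>))" and x = c] q
        by (simp add: interpolated_powr')
    qed auto
    then have le: "C * delta_lip p \<theta> x0 n \<sigma> x' x'' * delta_lin q \<nu> n c \<le> C * A powr (1 / u) * B powr (1 / v)"
      using C by (intro mult_mono[OF mult_left_mono[OF lip] lin]) auto
    have "(\<Sum>j<n. \<kappa> j powr (r' / u) * \<mu> j powr (r' / v) * t (i j)) = (\<Sum>j<n. \<bar>\<sigma> j * blinfun_apply (c j) (T (x' j) - T (x'' j))\<bar> powr r')"
    proof (intro sum.cong refl)
      fix j assume "j \<in> {..<n}"
      then show "\<kappa> j powr (r' / u) * \<mu> j powr (r' / v) * t (i j) = \<bar>\<sigma> j * blinfun_apply (c j) (T (x' j) - T (x'' j))\<bar> powr r'"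
        using pos[of j] by (simp add: t_def i \<sigma>_def c_def blinfun.scaleR_left abs_mult powr_mult powr_powr)
    qed
    also have "\<dots> = ((\<Sum>j<n. \<bar>\<sigma> j * blinfun_apply (c j) (T (x' j) - T (x'' j))\<bar> powr r') powr (1 / r')) powr r'"
      using r'(1) by (simp add: powr_powr sum_nonneg)
    also have "\<dots> \<le> (C * A powr (1 / u) * B powr (1 / v)) powr r'"
    proof (rule powr_mono2)
      show "(\<Sum>j<n. \<bar>\<sigma> j * blinfun_apply (c j) (T (x' j) - T (x'' j))\<bar> powr r') powr (1 / r') \<le> C * A powr (1 / u) * B powr (1 / v)"
        using seq[unfolded sequence_dominated_def, THEN conjunct2, rule_format, where m = n and x' = x' and x'' = x'' and \<sigma> = \<sigma> and b = c] le
        by (rule order_trans)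
    qed (use r'(1) in auto)
    also have "\<dots> = C powr r' * A powr (r' / u) * B powr (r' / v)"
      using C A0 B0 by (simp add: powr_mult powr_powr)
    finally show "(\<Sum>j<n. \<kappa> j powr (r' / u) * \<mu> j powr (r' / v) * t (i j)) \<le> C powr r' * A powr (r' / u) * B powr (r' / v)" .
  qed (use uv r' ab g_nonneg h_nonneg in auto)
  then obtain M N where M: "mean_on (lip_ball x0) M" and N: "mean_on (cball 0 1 :: 'b dual dual set) N"
      and MN: "\<And>i. t i \<le> C powr r' * M (g i) powr (r' / u) * N (h i) powr (r' / v)" by blast
  obtain \<mu> where \<mu>: "regular_borel_prob (lip_ball_topology x0) \<mu>"
      and M_le: "\<forall>g. continuous_map (lip_ball_topology x0) euclideanreal g \<longrightarrow> (\<forall>f\<in>lip_ball x0. 0 \<le> g f) \<longrightarrow> M g \<le> (\<integral>f. g f \<partial>\<mu>)"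
    using mean_below_regular_borel_prob[OF compact_space_lip_ball Hausdorff_space_lip_ball, of x0 M] M by auto
  obtain \<tau> where \<tau>: "regular_borel_prob (dual_ball_topology :: 'b dual dual topology) \<tau>"
      and N_le: "\<forall>g. continuous_map dual_ball_topology euclideanreal g \<longrightarrow> (\<forall>\<xi>\<in>cball 0 1. 0 \<le> g \<xi>) \<longrightarrow> N g \<le> (\<integral>\<xi>. g \<xi> \<partial>\<tau>)"
    using mean_below_regular_borel_prob[OF compact_space_dual_ball Hausdorff_space_dual_ball, of N] N by auto
  have M_nonneg: "0 \<le> M (g i)" and N_nonneg: "0 \<le> N (h i)" for i
    using continuous_map_bounded_image[OF compact_space_lip_ball g_cont[of i]]
      continuous_map_bounded_image[OF compact_space_dual_ball h_cont[of i]]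
    by (simp_all add: mean_onD(3)[OF M] mean_onD(3)[OF N] g_nonneg h_nonneg)
  have "\<bar>blinfun_apply b (T x' - T x'')\<bar> \<le> C * (\<integral>f. g (x', x'', b) f \<partial>\<mu>) powr (1 / u) * (\<integral>\<xi>. h (x', x'', b) \<xi> \<partial>\<tau>) powr (1 / v)" for x' x'' b
  proof -
    let ?i = "(x', x'', b)"
    have "M (g ?i) \<le> (\<integral>f. g ?i f \<partial>\<mu>)" "N (h ?i) \<le> (\<integral>\<xi>. h ?i \<xi> \<partial>\<tau>)"
      by (rule M_le[rule_format, OF g_cont g_nonneg] N_le[rule_format, OF h_cont h_nonneg])+
    then have "t ?i \<le> C powr r' * (\<integral>f. g ?i f \<partial>\<mu>) powr (r' / u) * (\<integral>\<xi>. h ?i \<xi> \<partial>\<tau>) powr (r' / v)"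
      using M_nonneg[of ?i] N_nonneg[of ?i] r'(1) uv C
      by (intro order_trans[OF MN] mult_mono powr_mono2) auto
    then have "t ?i powr (1 / r') \<le> (C powr r' * (\<integral>f. g ?i f \<partial>\<mu>) powr (r' / u) * (\<integral>\<xi>. h ?i \<xi> \<partial>\<tau>) powr (r' / v)) powr (1 / r')"
      using r'(1) by (intro powr_mono2) (auto simp: t_def)
    also have "\<dots> = C * (\<integral>f. g ?i f \<partial>\<mu>) powr (1 / u) * (\<integral>\<xi>. h ?i \<xi> \<partial>\<tau>) powr (1 / v)"
      using C r'(1) by (simp add: powr_mult powr_powr)
    finally show ?thesis using r'(1) by (simp add: t_def powr_powr)
  qed
  then show ?thesis
    unfolding integral_dominated_def g_def h_def u_def v_def prod.case divide_divide_eq_right mult_1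
    by (intro conjI C exI[of _ \<mu>] exI[of _ \<tau>] \<mu> \<tau> allI)
qed

text \<open>
  The operators are the canonical maps into \<open>L\<^sub>p (\<mu>)\<close> and \<open>L\<^sub>q (\<tau>)\<close>, which are summing with constant
  one. Only the distances \<open>\<rho>\<close> and the seminorm \<open>n\<close> that they induce matter, so both spaces are replaced by
  spaces of bounded functions, which lie in the universe. A larger constant \<open>C'\<close> is allowed because a
  dominating constant has to be positive, whereas \<open>C\<close> may be zero.
\<close>

lemma integral_dominated_imp_dominating:
  fixes T :: "'a::metric_space \<Rightarrow> 'b::banach"
  assumes int: "integral_dominated p \<theta> q \<nu> x0 T C" and C': "C \<le> C'" "0 < C'"
    and p: "1 \<le> p" "\<theta> < 1" and q: "1 \<le> q" "\<nu> < 1"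
  obtains G NG S H NH R where
    "dominating p \<theta> q \<nu> x0 T (G :: ('u::real_vector, 'a, 'b) universe set) NG S H NH R C'"
    "lip_summing_const p x0 NG S 1" "abs_summing_const q NH R 1"
proof -
  obtain \<mu> :: "('a \<Rightarrow> real) measure" and \<tau> :: "'b dual dual measure" where
    \<mu>: "regular_borel_prob (lip_ball_topology x0) \<mu>" and \<tau>: "regular_borel_prob dual_ball_topology \<tau>"
    and le: "\<And>x' x'' b. \<bar>blinfun_apply b (T x' - T x'')\<bar>
           \<le> C * (\<integral>f. (\<bar>f x' - f x''\<bar> powr (1 - \<theta>) * dist x' x'' powr \<theta>)
                        powr (p / (1 - \<theta>)) \<partial>\<mu>) powr ((1 - \<theta>) / p)
               * (\<integral>\<xi>. (\<bar>blinfun_apply \<xi> b\<bar> powr (1 - \<nu>) * norm b powr \<nu>)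
                        powr (q / (1 - \<nu>)) \<partial>\<tau>) powr ((1 - \<nu>) / q)"
    using int unfolding integral_dominated_def by blast
  interpret mu: prob_space \<mu> using \<mu> by (simp add: regular_borel_prob_def)
  interpret tau: prob_space \<tau> using \<tau> by (simp add: regular_borel_prob_def)
  have sp: "space \<mu> = lip_ball x0" "space \<tau> = cball 0 1"
    using \<mu> \<tau> by (simp_all add: regular_borel_prob_def)
  have int_mu: "integrable \<mu> (\<lambda>f. \<bar>f x - f y\<bar> powr p)" for x y
    using p by (intro regular_borel_prob_integrable[OF \<mu>] continuous_map_bounded_image[OF compact_space_lip_ball]
        continuous_map_powr_abs continuous_map_diff continuous_map_lip_ball_eval) auto
  have int_tau: "integrable \<tau> (\<lambda>\<xi>. \<bar>blinfun_apply \<xi> b\<bar> powr q)" for b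
    using q by (intro regular_borel_prob_integrable[OF \<tau>] continuous_map_bounded_image[OF compact_space_dual_ball]
        continuous_map_powr_abs continuous_map_dual_ball_eval) auto
  define \<rho> where "\<rho> x y = (\<integral>f. \<bar>f x - f y\<bar> powr p \<partial>\<mu>) powr (1 / p)" for x y
  define n where "n b = (\<integral>\<xi>. \<bar>blinfun_apply \<xi> b\<bar> powr q \<partial>\<tau>) powr (1 / q)" for b
  have \<rho>_powr: "(\<integral>f. \<bar>f x - f y\<bar> powr p \<partial>\<mu>) = \<rho> x y powr p" for x y
    using p by (simp add: \<rho>_def powr_powr)
  have n_powr: "(\<integral>\<xi>. \<bar>blinfun_apply \<xi> b\<bar> powr q \<partial>\<tau>) = n b powr q" for b
    using q by (simp add: n_def powr_powr)
  have \<rho>_nonneg: "0 \<le> \<rho> x y" and n_nonneg: "0 \<le> n b" for x y b by (simp_all add: \<rho>_def n_def)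
  have \<rho>_le: "\<rho> x y \<le> dist x y" for x y
  proof -
    have "(\<integral>f. \<bar>f x - f y\<bar> powr p \<partial>\<mu>) \<le> (\<integral>f. dist x y powr p \<partial>\<mu>)"
      using p by (intro integral_mono int_mu powr_mono2) (auto simp: sp lip_ball_iff)
    then have "\<rho> x y \<le> (dist x y powr p) powr (1 / p)"
      unfolding \<rho>_def using p by (intro powr_mono2) (auto simp: mu.prob_space)
    then show ?thesis using p by (simp add: powr_powr)
  qed
  have n_le: "n b \<le> norm b" for b
  proof -
    have "(\<integral>\<xi>. \<bar>blinfun_apply \<xi> b\<bar> powr q \<partial>\<tau>) \<le> (\<integral>\<xi>. norm b powr q \<partial>\<tau>)"
      using q by (intro integral_mono int_tau powr_mono2 in_dual_ball_abs_le) (auto simp: sp)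
    then have "n b \<le> (norm b powr q) powr (1 / q)"
      unfolding n_def using q by (intro powr_mono2) (auto simp: tau.prob_space)
    then show ?thesis using q by (simp add: powr_powr)
  qed
  have \<rho>_tri: "\<rho> x z \<le> \<rho> x y + \<rho> y z" for x y z
    using Minkowski_integral[OF p(1) int_mu[of x y] int_mu[of y z]] int_mu[of x z] by (simp add: \<rho>_def)
  obtain S :: "'a \<Rightarrow> ('a discrete \<Rightarrow>\<^sub>C real)" where S0: "S x0 = 0" and S: "\<And>x y. norm (S x - S y) = \<rho> x y"
  proof (rule sup_distance_embedding[of \<rho> x0])
    show "\<rho> x x = 0" for x using p by (simp add: \<rho>_def)
    show "\<rho> x y = \<rho> y x" for x y by (simp add: \<rho>_def abs_minus_commute)
  qed (use \<rho>_tri in blast)+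
  have n_scale: "n (t *\<^sub>R b) = \<bar>t\<bar> * n b" for t b
    using q by (simp add: n_def blinfun.scaleR_right abs_mult powr_mult powr_powr)
  have "sublinear n"
    unfolding sublinear_def
  proof (intro conjI allI impI)
    show "n (a + b) \<le> n a + n b" for a b
      using Minkowski_integral[OF q(1) int_tau[of a] int_tau[of b]] int_tau[of "a + b"]
      by (simp add: n_def blinfun.add_right)
  qed (simp add: n_scale)
  moreover have "n (- b) = n b" for b using n_scale[of "- 1" b] by simp
  ultimately obtain R :: "'b dual \<Rightarrow> ('b dual discrete \<Rightarrow>\<^sub>C real)" where R_lin: "linear R" and R: "\<And>b. norm (R b) = n b"
    using seminorm_embedding[of n] by blast
  \<comment> \<open>The two function spaces sit in the universe as its second and third factors.\<close>
  define JG :: "('a discrete \<Rightarrow>\<^sub>C real) \<Rightarrow> ('u, 'a, 'b) universe" where "JG g = (0, g, 0)" for g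
  define JH :: "('b dual discrete \<Rightarrow>\<^sub>C real) \<Rightarrow> ('u, 'a, 'b) universe" where "JH h = (0, 0, h)" for h
  define NG where "NG x = norm (inv JG x)" for x
  define NH where "NH x = norm (inv JH x)" for x
  have JG: "linear JG" "inj JG" by (auto simp: JG_def inj_def intro!: linearI)
  have JH: "linear JH" "inj JH" by (auto simp: JH_def inj_def intro!: linearI)
  have NG_S: "NG (JG (S x) - JG (S y)) = \<rho> x y" for x y
    by (simp add: NG_def JG(2) S flip: linear_diff[OF JG(1)])
  have NH_R: "NH (JH (R b)) = n b" for b by (simp add: NH_def JH(2) R)
  have sup_mu: "(\<Sum>j<m. w j powr p * \<rho> (x' j) (x'' j) powr p) powr (1 / p)
      \<le> (SUP f\<in>lip_ball x0. (\<Sum>j<m. w j powr p * \<bar>f (x' j) - f (x'' j)\<bar> powr p) powr (1 / p))" for m :: nat and w x' x''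
    using powr_mean_le_SUP[OF compact_space_lip_ball \<mu>, of p "\<lambda>j f. f (x' j) - f (x'' j)" "\<lambda>j. w j powr p" m] p
    by (simp add: \<rho>_powr continuous_map_diff continuous_map_lip_ball_eval)
  have sup_tau: "(\<Sum>j<m. n (b j) powr q) powr (1 / q)
      \<le> (SUP \<xi>\<in>cball 0 1. (\<Sum>j<m. \<bar>blinfun_apply \<xi> (b j)\<bar> powr q) powr (1 / q))" for m :: nat and b
    using powr_mean_le_SUP[OF compact_space_dual_ball \<tau>, of q "\<lambda>j \<xi>. blinfun_apply \<xi> (b j)" "\<lambda>_. 1" m] q
    by (simp add: n_powr continuous_map_dual_ball_eval)
  have Sc: "lip_summing_const p x0 NG (JG \<circ> S) 1"
    unfolding lip_summing_const_def using sup_mu by (simp add: NG_S)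
  have Rc: "abs_summing_const q NH (JH \<circ> R) 1"
    unfolding abs_summing_const_def using sup_tau by (simp add: NH_R)
  have bound: "\<bar>blinfun_apply b (T x' - T x'')\<bar>
      \<le> C' * dist x' x'' powr \<theta> * \<rho> x' x'' powr (1 - \<theta>) * norm b powr \<nu> * n b powr (1 - \<nu>)" for x' x'' b
  proof -
    have "(\<integral>f. (\<bar>f x' - f x''\<bar> powr (1 - \<theta>) * dist x' x'' powr \<theta>) powr (p / (1 - \<theta>)) \<partial>\<mu>)
        = ((dist x' x'' powr \<theta>) powr (1 / (1 - \<theta>))) powr p * \<rho> x' x'' powr p"
      using p by (simp add: interpolated_powr' \<rho>_powr)
    also have "\<dots> powr ((1 - \<theta>) / p) = dist x' x'' powr \<theta> * \<rho> x' x'' powr (1 - \<theta>)"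
      using p \<rho>_nonneg by (simp add: powr_mult powr_powr)
    finally have 1: "(\<integral>f. (\<bar>f x' - f x''\<bar> powr (1 - \<theta>) * dist x' x'' powr \<theta>) powr (p / (1 - \<theta>)) \<partial>\<mu>) powr ((1 - \<theta>) / p)
        = dist x' x'' powr \<theta> * \<rho> x' x'' powr (1 - \<theta>)" .
    have "(\<integral>\<xi>. (\<bar>blinfun_apply \<xi> b\<bar> powr (1 - \<nu>) * norm b powr \<nu>) powr (q / (1 - \<nu>)) \<partial>\<tau>)
        = ((norm b powr \<nu>) powr (1 / (1 - \<nu>))) powr q * n b powr q"
      using q by (simp add: interpolated_powr' n_powr)
    also have "\<dots> powr ((1 - \<nu>) / q) = norm b powr \<nu> * n b powr (1 - \<nu>)"
      using q n_nonneg by (simp add: powr_mult powr_powr)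
    finally have 2: "(\<integral>\<xi>. (\<bar>blinfun_apply \<xi> b\<bar> powr (1 - \<nu>) * norm b powr \<nu>) powr (q / (1 - \<nu>)) \<partial>\<tau>) powr ((1 - \<nu>) / q)
        = norm b powr \<nu> * n b powr (1 - \<nu>)" .
    have "\<bar>blinfun_apply b (T x' - T x'')\<bar> \<le> C * (dist x' x'' powr \<theta> * \<rho> x' x'' powr (1 - \<theta>)) * (norm b powr \<nu> * n b powr (1 - \<nu>))"
      using le[of b x' x''] unfolding 1 2 .
    also have "\<dots> \<le> C' * (dist x' x'' powr \<theta> * \<rho> x' x'' powr (1 - \<theta>)) * (norm b powr \<nu> * n b powr (1 - \<nu>))"
      using C'(1) by (intro mult_right_mono) auto
    finally show ?thesis by (simp add: mult_ac)
  qed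
  have "dominating p \<theta> q \<nu> x0 T (range JG) NG (JG \<circ> S) (range JH) NH (JH \<circ> R) C'"
    unfolding dominating_def
  proof (intro conjI allI)
    show "banach_on (range JG) NG" unfolding NG_def by (rule banach_on_range[OF JG])
    show "banach_on (range JH) NH" unfolding NH_def by (rule banach_on_range[OF JH])
    have "(JG \<circ> S) x0 = 0" using linear_0[OF JG(1)] by (simp add: S0)
    moreover have "\<forall>x y. NG ((JG \<circ> S) x - (JG \<circ> S) y) \<le> 1 * dist x y" by (simp add: NG_S \<rho>_le)
    moreover have "range (JG \<circ> S) \<subseteq> range JG" by auto
    ultimately have "JG \<circ> S \<in> lip0_into x0 (range JG) NG" unfolding lip0_into_def by blast
    then show "JG \<circ> S \<in> lip_summing p x0 (range JG) NG" using Sc unfolding lip_summing_def by blast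
    have "linear (JH \<circ> R)" by (rule linear_compose[OF R_lin JH(1)])
    moreover have "\<forall>b. NH ((JH \<circ> R) b) \<le> 1 * norm b" by (simp add: NH_R n_le)
    moreover have "range (JH \<circ> R) \<subseteq> range JH" by auto
    ultimately show "JH \<circ> R \<in> abs_summing q (range JH) NH" using Rc unfolding abs_summing_def by blast
    show "\<bar>blinfun_apply b (T x' - T x'')\<bar> \<le> C' * dist x' x'' powr \<theta> * NG ((JG \<circ> S) x' - (JG \<circ> S) x'') powr (1 - \<theta>)
        * norm b powr \<nu> * NH ((JH \<circ> R) b) powr (1 - \<nu>)" for x' x'' b
      using bound by (simp add: NG_S NH_R)
  qed (rule C'(2))
  then show thesis using that Sc Rc by blast
qed

section \<open>The equivalence and the equality of the constants\<close>

theorem theorem3: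
  fixes p q r r' \<theta> \<nu> :: real
    and x0 :: "'a::metric_space"
    and T :: "'a \<Rightarrow> 'b::banach"
  assumes "1 \<le> p" and "1 \<le> q" and "0 \<le> \<theta>" and "\<theta> < 1" and "0 \<le> \<nu>" and "\<nu> < 1" and "1 \<le> r"
    and "1 / r + (1 - \<theta>) / p + (1 - \<nu>) / q = 1"
    and "1 / r + 1 / r' = 1"
    and "T \<in> lip0 x0"
  shows "(T \<in> lip_dominated TYPE('u::real_vector) p \<theta> q \<nu> x0
            \<longleftrightarrow> (\<exists>C. integral_dominated p \<theta> q \<nu> x0 T C)) \<and>
         ((\<exists>C. integral_dominated p \<theta> q \<nu> x0 T C)
            \<longleftrightarrow> (\<exists>C. sequence_dominated p \<theta> q \<nu> r' x0 T C)) \<and>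
         (T \<in> lip_dominated TYPE('u) p \<theta> q \<nu> x0 \<longrightarrow>
            lip_dominated_norm TYPE('u) p \<theta> q \<nu> x0 T = Inf {C. integral_dominated p \<theta> q \<nu> x0 T C} \<and>
            lip_dominated_norm TYPE('u) p \<theta> q \<nu> x0 T = Inf {C. sequence_dominated p \<theta> q \<nu> r' x0 T C})"
proof -
  have p: "0 < p" and q: "0 < q" using assms by auto
  have e: "1 / r' = (1 - \<theta>) / p + (1 - \<nu>) / q" using assms(8,9) by linarith
  moreover have "0 < (1 - \<theta>) / p" "0 < (1 - \<nu>) / q" using assms p q by auto
  ultimately have "0 < 1 / r'" by linarith
  then have r': "0 < r'" by simp
  define \<D> where "\<D> = {C * lip_summing_norm p x0 NG S powr (1 - \<theta>) * abs_summing_norm q NH R powr (1 - \<nu>)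
      | (G :: ('u, 'a, 'b) universe set) NG S (H :: ('u, 'a, 'b) universe set) NH R C.
          dominating p \<theta> q \<nu> x0 T G NG S H NH R C}"
  define \<I> where "\<I> = {C. integral_dominated p \<theta> q \<nu> x0 T C}"
  define \<S> where "\<S> = {C. sequence_dominated p \<theta> q \<nu> r' x0 T C}"
  have DS: "\<D> \<subseteq> \<S>"
    unfolding \<D>_def \<S>_def
    using dominating_imp_sequence_dominated[OF _ p assms(4) q assms(6) r' e] by blast
  have SI: "\<S> \<subseteq> \<I>"
    unfolding \<I>_def \<S>_def
    using sequence_dominated_imp_integral_dominated[OF _ p assms(4) q assms(6) r' e] by blast
  \<comment> \<open>Both summing constants of the constructed operators are at most one, so the value they give is at most \<open>C'\<close>.\<close>
  have ID: "\<exists>c\<in>\<D>. c \<le> C'" if C: "C \<in> \<I>" "C \<le> C'" "0 < C'" for C C'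
  proof -
    have "integral_dominated p \<theta> q \<nu> x0 T C" using C(1) by (simp add: \<I>_def)
    then obtain G NG S H NH R where
      dom: "dominating p \<theta> q \<nu> x0 T (G :: ('u, 'a, 'b) universe set) NG S H NH R C'"
      and Sc: "lip_summing_const p x0 NG S 1" and Rc: "abs_summing_const q NH R 1"
      using integral_dominated_imp_dominating[OF _ C(2,3) assms(1,4,2,6)] by metis
    let ?s = "lip_summing_norm p x0 NG S" and ?t = "abs_summing_norm q NH R"
    have "0 \<le> ?s" "0 \<le> ?t"
      using lip_summing_const_norm[OF Sc] abs_summing_const_norm[OF Rc]
      by (auto simp: lip_summing_const_def abs_summing_const_def)
    then have "?s powr (1 - \<theta>) \<le> 1 powr (1 - \<theta>)" "?t powr (1 - \<nu>) \<le> 1 powr (1 - \<nu>)"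
      using lip_summing_norm_le[OF Sc] abs_summing_norm_le[OF Rc] assms(4,6) by (auto intro!: powr_mono2 simp del: powr_one_eq_one)
    then have "C' * ?s powr (1 - \<theta>) * ?t powr (1 - \<nu>) \<le> C' * 1 * 1"
      using C(3) by (intro mult_mono) auto
    moreover have "C' * ?s powr (1 - \<theta>) * ?t powr (1 - \<nu>) \<in> \<D>" using dom unfolding \<D>_def by blast
    ultimately show ?thesis by auto
  qed
  have I_nonneg: "0 \<le> C" if "C \<in> \<I>" for C using that by (simp add: \<I>_def integral_dominated_def)
  have ne: "\<D> \<noteq> {} \<longleftrightarrow> \<I> \<noteq> {}" "\<I> \<noteq> {} \<longleftrightarrow> \<S> \<noteq> {}"
  proof -
    have "\<D> \<noteq> {}" if I: "\<I> \<noteq> {}"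
    proof -
      obtain C where C: "C \<in> \<I>" using I by blast
      then have "C \<le> C + 1" "0 < C + 1" using I_nonneg[of C] by auto
      then show ?thesis using ID[OF C] by blast
    qed
    then show "\<D> \<noteq> {} \<longleftrightarrow> \<I> \<noteq> {}" "\<I> \<noteq> {} \<longleftrightarrow> \<S> \<noteq> {}" using DS SI by blast+
  qed
  have D_iff: "T \<in> lip_dominated TYPE('u) p \<theta> q \<nu> x0 \<longleftrightarrow> \<D> \<noteq> {}"
    using assms(10) unfolding lip_dominated_def \<D>_def by blast
  have "Inf \<D> = Inf \<I> \<and> Inf \<D> = Inf \<S>" if "\<D> \<noteq> {}"
  proof -
    have ne': "\<D> \<noteq> {}" "\<S> \<noteq> {}" "\<I> \<noteq> {}" using that ne by auto
    have bdd: "bdd_below \<I>" "bdd_below \<S>" "bdd_below \<D>"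
      using I_nonneg DS SI by (auto intro!: bdd_belowI[of _ 0])
    have "Inf \<I> \<le> Inf \<S>" "Inf \<S> \<le> Inf \<D>" using cInf_superset_mono ne' bdd DS SI by blast+
    moreover have "Inf \<D> \<le> Inf \<I>"
    proof (rule cInf_greatest[OF ne'(3)])
      fix C assume C: "C \<in> \<I>"
      show "Inf \<D> \<le> C"
      proof (rule field_le_epsilon)
        fix e :: real assume "0 < e"
        then obtain c where "c \<in> \<D>" "c \<le> C + e" using ID[OF C, of "C + e"] I_nonneg[OF C] by auto
        then show "Inf \<D> \<le> C + e" using cInf_lower[OF _ bdd(3)] order_trans by blast
      qed
    qed
    ultimately show ?thesis by linarith
  qed
  moreover have "(\<exists>C. integral_dominated p \<theta> q \<nu> x0 T C) \<longleftrightarrow> \<I> \<noteq> {}"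
    and "(\<exists>C. sequence_dominated p \<theta> q \<nu> r' x0 T C) \<longleftrightarrow> \<S> \<noteq> {}"
    by (simp_all add: \<I>_def \<S>_def)
  moreover have "lip_dominated_norm TYPE('u) p \<theta> q \<nu> x0 T = Inf \<D>"
    by (simp only: lip_dominated_norm_def \<D>_def)
  ultimately show ?thesis
    unfolding D_iff \<I>_def[symmetric] \<S>_def[symmetric] using ne by metis
qed

end
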